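(* Every $R$-sparse tensor $A\in\mathbb{R}^{d_1\times\cdots\times d_M}$ can be represented in a sparsely canonicalised tensor train format $$ A=U^{(1)}\circ\cdots\circ U^{(k-1)}\circ C\circ V^{(k+1)}\circ\cdots\circ V^{(M)} $$ with ranks that are uniformly bounded by $R$, independent of the chosen core position $k\in[M]$. Moreover, one can define the operator $Q\in\mathcal{L}\big(\mathbb{R}^{r_{k-1}\times d_k\times r_k},\mathbb{R}^{d_1\times\cdots\times d_M}\big)\simeq\mathbb{R}^{d_1\cdots d_M\times r_{k-1}d_kr_k}$ via $$ Q=\operatorname{unfold}_k\big(U^{(1)}\circ\cdots\circ U^{(k-1)}\big)\otimes I_{d_k}\otimes\operatorname{unfold}_1\big(V^{(k+1)}\circ\cdots\circ V^{(M)}\big)^{\intercal}, $$ where $\otimes$ denotes the matrix Kronecker product. This means that $A=QC$. Interpreted as a matrix, $Q$ is left-orthogonal (i.e. $Q^\intercal Q=I$) and its columns are standard basis vectors, and for every $q\in[0,\infty]$ and $\omega\in[0,\infty]^{d_1\times\cdots\times d_M}$ it holds that $$ \|A\|_{\ell^q_\omega}=\|C\|_{\ell^q_\beta}, $$ where $\beta:=Q^\intercal\omega$ is a (reshaped) subsequence of $\omega$.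
   Context: $[M]=\{1,\ldots,M\}$. A tensor is $R$-sparse if it has $R$ non-zero entries. Contraction: for $A\in\mathbb{R}^{d_1\times\cdots\times d_m}$ and $B\in\mathbb{R}^{d_m\times\cdots\times d_N}$, $(A\circ B)_{i_1,\ldots,i_{m-1},i_{m+1},\ldots,i_N}:=\sum_{i_m}A_{i_1,\ldots,i_m}B_{i_m,\ldots,i_N}$. A tensor train (TT) representation of $A\in\mathbb{R}^{d_1\times\cdots\times d_M}$ is $A=A^{(1)}\circ\cdots\circ A^{(M)}$ with $A^{(j)}\in\mathbb{R}^{r_{j-1}\times d_j\times r_j}$ and $r_0=r_M=1$ (modes of size one are identified away); $r_1,\ldots,r_{M-1}$ are the ranks. Empty contractions are the scalar $1$. Vectorisation is row-major (last index fastest). For a tensor $T\in\mathbb{R}^{e_1\times\cdots\times e_N}$, $\operatorname{unfold}_k(T)$ is the matrix of size $(e_1\cdots e_k)\times(e_{k+1}\cdots e_N)$ with the same vectorisation as $T$. $T$ is left-orthogonal if $\operatorname{unfold}_{N-1}(T)^\intercal\operatorname{unfold}_{N-1}(T)=I$ and right-orthogonal if $\operatorname{unfold}_1(T)\operatorname{unfold}_1(T)^\intercal=I$. (In $\operatorname{unfold}_k(U^{(1)}\circ\cdots\circ U^{(k-1)})$ the leading mode of size $r_0=1$ is counted, so this matrix has size $(d_1\cdots d_{k-1})\times r_{k-1}$; similarly $\operatorname{unfold}_1(V^{(k+1)}\circ\cdots\circ V^{(M)})$ has size $r_k\times(d_{k+1}\cdots d_M)$.) A TT representation $A=U^{(1)}\circ\cdots\circ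 U^{(k-1)}\circ C\circ V^{(k+1)}\circ\cdots\circ V^{(M)}$ is called sparsely canonicalised with core position $k$ if (1) $U^{(j)}\in\{0,1\}^{r_{j-1}\times d_j\times r_j}$ is left-orthogonal and $r_j$-sparse for all $1\le j<k$; (2) $V^{(j)}\in\{0,1\}^{r_{j-1}\times d_j\times r_j}$ is right-orthogonal and $r_{j-1}$-sparse for all $k<j\le M$; (3) $C\in\mathbb{R}^{r_{k-1}\times d_k\times r_k}$ is $\min\{r_{k-1},r_k\}$-sparse. Weighted norms: $\|v\|_{\ell^q_\omega}:=\|\omega v\|_{\ell^q}$ (element-wise product) for $0<q\le\infty$, and $\|v\|_{\ell^0_\omega}:=\sum_{j:\,v_j\neq0}\omega_j^2$.
   Formalization: Condition (3), that C is min{r_{k-1},r_k}-sparse, fails in general (e.g. M=k=1, A=(1,1)); the formal theorem always gives an R-sparse C and asserts (3) when 1 ≤ R ≤ d_1⋯d_{k-1} and R ≤ d_{k+1}⋯d_M, which for R ≥ 1 is exactly where (3) is attainable. *)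

theory Defs
  imports
    Complex_Main
    "HOL-Library.Extended_Nonnegative_Real"
    "HOL-Library.Sublist"
    "Jordan_Normal_Form.Matrix"
begin

section \<open>Tensors\<close>

text \<open>
  The order of a tensor is the length of its list of mode sizes, so tensors of all orders live in
  one type. Entries are indexed by lists and count from 0 (as in the matrix library), whereas modes
  count from 1. The values of \<open>entry T\<close> outside \<open>indices (dims T)\<close> are irrelevant.
\<close>

datatype 'a tensor = Tensor (dims: "nat list") (entry: "nat list \<Rightarrow> 'a")

definition indices :: "nat list \<Rightarrow> nat list set" where
  "indices ds = {is. length is = length ds \<and> (\<forall>j < length ds. is ! j < ds ! j)}"

definition sparse :: "nat \<Rightarrow> 'a::zero tensor \<Rightarrow> bool" where
  "sparse R T \<longleftrightarrow> card {is \<in> indices (dims T). entry T is \<noteq> 0} = R"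

definition binary :: "real tensor \<Rightarrow> bool" where
  "binary T \<longleftrightarrow> (\<forall>is \<in> indices (dims T). entry T is \<in> {0, 1})"

text \<open>The multi-index at position \<open>n\<close> of the row-major order (last index fastest).\<close>

fun row_major :: "nat list \<Rightarrow> nat \<Rightarrow> nat list" where
  "row_major [] n = []"
| "row_major (d # ds) n = (n div prod_list ds) # row_major ds (n mod prod_list ds)"

definition vectorise :: "'a tensor \<Rightarrow> 'a vec" where
  "vectorise T = vec (prod_list (dims T)) (\<lambda>n. entry T (row_major (dims T) n))"

definition unfold :: "nat \<Rightarrow> 'a tensor \<Rightarrow> 'a mat" where
  "unfold k T =
    (let m = prod_list (take k (dims T)); n = prod_list (drop k (dims T))
     in mat m n (\<lambda>(i, j). vectorise T $ (i * n + j)))"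

definition left_orthogonal :: "real tensor \<Rightarrow> bool" where
  "left_orthogonal T \<longleftrightarrow>
    (let X = unfold (length (dims T) - 1) T in transpose_mat X * X = 1\<^sub>m (dim_col X))"

definition right_orthogonal :: "real tensor \<Rightarrow> bool" where
  "right_orthogonal T \<longleftrightarrow>
    (let X = unfold 1 T in X * transpose_mat X = 1\<^sub>m (dim_row X))"

text \<open>Only used when the last mode of the first tensor and the first mode of the second agree.\<close>

definition contract :: "real tensor \<Rightarrow> real tensor \<Rightarrow> real tensor" (infixr "\<circ>\<^sub>t" 70) where
  "A \<circ>\<^sub>t B =
    (let p = length (dims A) - 1 in
     Tensor (butlast (dims A) @ tl (dims B))
       (\<lambda>is. \<Sum>i < last (dims A). entry A (take p is @ [i]) * entry B (i # drop p is)))"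

text \<open>
  The contraction of a sequence of cores, associated to the right. No modes of size one are dropped, so for cores of
  sizes \<open>r (i - 1), d i, r i\<close> for \<open>i = a, \<dots>, b\<close>, the result has the mode sizes
  \<open>r (a - 1), d a, \<dots>, d b, r b\<close>. The empty contraction is the scalar 1, equipped with the two
  boundary modes of size \<open>r 0 = 1\<close> (or \<open>r M = 1\<close>).
\<close>

fun chain :: "real tensor list \<Rightarrow> real tensor" where
  "chain [] = Tensor [1, 1] (\<lambda>_. 1)"
| "chain [T] = T"
| "chain (T # T' # Ts) = T \<circ>\<^sub>t chain (T' # Ts)"


section \<open>Tensor trains\<close>

text \<open>
  \<open>A = U 1 \<circ> \<dots> \<circ> U (k - 1) \<circ> C \<circ> V (k + 1) \<circ> \<dots> \<circ> V M\<close> with mode sizes \<open>d 1, \<dots>, d M\<close> and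
  ranks \<open>r 1, \<dots>, r (M - 1)\<close>. The two boundary modes of size \<open>r 0 = r M = 1\<close>, whose only index is 0,
  are identified away. The ranks are allowed to be 0, which is what the zero tensor needs for
  its ranks to be bounded by its number 0 of non-zero entries.
\<close>

definition tt_representation ::
  "nat \<Rightarrow> (nat \<Rightarrow> nat) \<Rightarrow> (nat \<Rightarrow> nat) \<Rightarrow> nat \<Rightarrow>
   (nat \<Rightarrow> real tensor) \<Rightarrow> real tensor \<Rightarrow> (nat \<Rightarrow> real tensor) \<Rightarrow> real tensor \<Rightarrow> bool" where
  "tt_representation M d r k U C V A \<longleftrightarrow>
     r 0 = 1 \<and> r M = 1 \<and>
     (\<forall>j \<in> {1..<k}. dims (U j) = [r (j - 1), d j, r j]) \<and>
     dims C = [r (k - 1), d k, r k] \<and>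
     (\<forall>j \<in> {k<..M}. dims (V j) = [r (j - 1), d j, r j]) \<and>
     dims A = map d [1..<M + 1] \<and>
     (\<forall>is \<in> indices (dims A).
        entry A is = entry (chain (map U [1..<k] @ [C] @ map V [k + 1..<M + 1])) ([0] @ is @ [0]))"

definition sparse_orthogonal_frames ::
  "nat \<Rightarrow> (nat \<Rightarrow> nat) \<Rightarrow> nat \<Rightarrow> (nat \<Rightarrow> real tensor) \<Rightarrow> (nat \<Rightarrow> real tensor) \<Rightarrow> bool" where
  "sparse_orthogonal_frames M r k U V \<longleftrightarrow>
     (\<forall>j \<in> {1..<k}. binary (U j) \<and> left_orthogonal (U j) \<and> sparse (r j) (U j)) \<and>
     (\<forall>j \<in> {k<..M}. binary (V j) \<and> right_orthogonal (V j) \<and> sparse (r (j - 1)) (V j))"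

text \<open>
  The frame conditions make the matrix of \<open>C \<mapsto> A\<close> (see \<open>core_operator\<close> below) a selection of
  distinct standard basis vectors, so \<open>C\<close> always has exactly as many non-zero entries as \<open>A\<close>.
  Hence the last condition below can only hold if the number of non-zero entries of \<open>A\<close> equals
  \<open>min (r (k - 1)) (r k)\<close>. By left- and right-orthogonality, this minimum is bounded by
  \<open>d 1 * \<dots> * d (k - 1)\<close> and by \<open>d (k + 1) * \<dots> * d M\<close>; in particular it is at most 1 for \<open>k = 1\<close>
  and for \<open>k = M\<close>, where one of these products is empty.
\<close>

definition sparsely_canonicalised ::
  "nat \<Rightarrow> (nat \<Rightarrow> nat) \<Rightarrow> (nat \<Rightarrow> nat) \<Rightarrow> nat \<Rightarrow>
   (nat \<Rightarrow> real tensor) \<Rightarrow> real tensor \<Rightarrow> (nat \<Rightarrow> real tensor) \<Rightarrow> real tensor \<Rightarrow> bool" where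
  "sparsely_canonicalised M d r k U C V A \<longleftrightarrow>
     tt_representation M d r k U C V A \<and>
     sparse_orthogonal_frames M r k U V \<and>
     sparse (min (r (k - 1)) (r k)) C"

definition kronecker :: "'a::times mat \<Rightarrow> 'a mat \<Rightarrow> 'a mat" (infixl "\<otimes>\<^sub>K" 70) where
  "X \<otimes>\<^sub>K Y =
    mat (dim_row X * dim_row Y) (dim_col X * dim_col Y)
      (\<lambda>(i, j). X $$ (i div dim_row Y, j div dim_col Y) * Y $$ (i mod dim_row Y, j mod dim_col Y))"

definition core_operator ::
  "nat \<Rightarrow> (nat \<Rightarrow> nat) \<Rightarrow> nat \<Rightarrow> (nat \<Rightarrow> real tensor) \<Rightarrow> (nat \<Rightarrow> real tensor) \<Rightarrow> real mat" where
  "core_operator M d k U V =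
     unfold k (chain (map U [1..<k]))
     \<otimes>\<^sub>K 1\<^sub>m (d k)
     \<otimes>\<^sub>K transpose_mat (unfold 1 (chain (map V [k + 1..<M + 1])))"


section \<open>Weighted norms\<close>

text \<open>Powers with a positive real exponent.\<close>

definition ennpow :: "ennreal \<Rightarrow> real \<Rightarrow> ennreal" where
  "ennpow x p = (if x = \<infinity> then \<infinity> else ennreal (enn2real x powr p))"

text \<open>
  Weights may be infinite; the products below follow the convention \<open>\<infinity> * 0 = 0\<close> of
  \<^typ>\<open>ennreal\<close>. A supremum over an empty index set is 0.
\<close>

definition weighted_norm :: "ennreal \<Rightarrow> ennreal vec \<Rightarrow> real vec \<Rightarrow> ennreal" where
  "weighted_norm q w v =
    (if q = 0 then (\<Sum>j | j < dim_vec v \<and> v $ j \<noteq> 0. (w $ j)\<^sup>2)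
     else if q = \<infinity> then (SUP j \<in> {..<dim_vec v}. w $ j * ennreal \<bar>v $ j\<bar>)
     else ennpow (\<Sum>j < dim_vec v. ennpow (w $ j * ennreal \<bar>v $ j\<bar>) (enn2real q))
            (1 / enn2real q))"

end

theory Submission
  imports Defs
begin

text \<open>
  Multi-indices are numbered by their row-major position. The position of a prefix is then a quotient,
  and the position of a suffix a remainder, of the position of the whole multi-index. Choose sets
  \<open>S j\<close> (for \<open>j < k\<close>) of prefixes of length \<open>j\<close> and sets \<open>T j\<close> (for \<open>j \<ge> k\<close>) of suffixes that follow
  mode \<open>j\<close>, such that dropping the last index of a prefix, or the first index of a suffix, leads
  from each set to its neighbour, and such that every non-zero entry of \<open>A\<close> has its prefix in
  \<open>S (k - 1)\<close> and its suffix in \<open>T k\<close>. The ranks are the cardinalities of these sets. Truncating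
  prefixes and suffixes of \<open>R\<close> multi-indices gives at most \<open>R\<close> of them, hence the rank bound, which
  does not depend on \<open>k\<close> (\<open>prefix_family\<close>, \<open>suffix_family\<close>).

  The core \<open>U j\<close> has the entry 1 exactly where the \<open>b\<close>-th prefix of length \<open>j\<close> arises from the \<open>a\<close>-th
  prefix of length \<open>j - 1\<close> by appending \<open>i\<close>. Each prefix arises in one way only, and distinct prefixes
  arise in distinct ways, so \<open>U j\<close> is a sparse orthogonal frame (\<open>prefix_core_frame\<close>). Contracting these cores
  spells out whole prefixes: the contraction is 1 at a multi-index and \<open>b\<close> exactly if that multi-index is the
  \<open>b\<close>-th element of \<open>S (k - 1)\<close> (\<open>entry_chain_prefix\<close>). The \<open>V j\<close> treat suffixes in the same way.

  Consequently both unfoldings in the definition of \<open>Q\<close> have distinct standard basis vectors as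
  columns (up to transposition), and so has their Kronecker product: \<open>Q\<close> has its ones at the places
  \<open>(f m, m)\<close> for an injective map \<open>f\<close>, whose range contains the support of \<open>A\<close>. Let \<open>C\<close> be \<open>A\<close> read along \<open>f\<close>. Then
  \<open>A = Q C\<close>, the transpose of \<open>Q\<close> restricts \<open>\<omega>\<close> to the range of \<open>f\<close>, and the entries of \<open>A\<close> which \<open>C\<close>
  omits are zeros, which do not contribute to any weighted norm. Enumerating the sets in increasing
  order makes \<open>f\<close> strictly increasing, and this is why \<open>\<beta>\<close> is a subsequence of \<open>\<omega>\<close>.

  Two details are dictated by degenerate cases. The outermost sets \<open>S 0\<close> and \<open>T M\<close> always consist of
  the empty multi-index, because the boundary ranks are 1 even for \<open>A = 0\<close>. The innermost sets
  \<open>S (k - 1)\<close> and \<open>T k\<close> are enlarged to \<open>R\<close> elements whenever there are enough multi-indices, because several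
  non-zero entries may share a prefix or a suffix, whereas the core of a sparsely canonicalised
  representation has to be \<open>min (r (k - 1)) (r k)\<close>-sparse.
\<close>


section \<open>Row-major positions\<close>

lemma div_mod_unique: "(i::nat) < d \<Longrightarrow> n = a * d + i \<longleftrightarrow> n div d = a \<and> n mod d = i"
  by (metis div_mult_mod_eq add.commute add.right_neutral div_less div_mult_self3
      less_nat_zero_code mod_less mod_mult_self3)

fun position :: "nat list \<Rightarrow> nat list \<Rightarrow> nat" where
  "position (d # ds) (i # is) = i * prod_list ds + position ds is"
| "position _ _ = 0"

lemma indices_Nil [simp]: "is \<in> indices [] \<longleftrightarrow> is = []"
  by (auto simp: indices_def)

lemma indices_Cons [simp]: "i # is \<in> indices (d # ds) \<longleftrightarrow> i < d \<and> is \<in> indices ds"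
  by (auto simp: indices_def nth_Cons less_Suc_eq_0_disj split: nat.splits)

lemma indices_ConsE:
  assumes "is \<in> indices (d # ds)"
  obtains i js where "is = i # js" "i < d" "js \<in> indices ds"
  using assms by (cases "is") (auto, simp add: indices_def)

lemma indices_length: "is \<in> indices ds \<Longrightarrow> length is = length ds"
  by (simp add: indices_def)

lemma indices_appendE:
  assumes "is \<in> indices (ds @ es)"
  obtains js ks where "is = js @ ks" "js \<in> indices ds" "ks \<in> indices es"
  using assms
proof (induction ds arbitrary: "is" thesis)
  case (Cons d ds)
  from Cons.prems(2) obtain i js where i: "is = i # js" "i < d" "js \<in> indices (ds @ es)"
    by (auto elim: indices_ConsE)
  obtain js' ks where "js = js' @ ks" "js' \<in> indices ds" "ks \<in> indices es"
    using Cons.IH[OF _ i(3)] by blast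
  then show ?case using i Cons.prems(1)[of "i # js'" ks] by simp
qed simp

lemma indices_tripleE:
  assumes "is \<in> indices [p, d, q]"
  obtains a i b where "is = [a, i, b]" "a < p" "i < d" "b < q"
  using assms by (auto elim!: indices_ConsE)

lemma position_less: "is \<in> indices ds \<Longrightarrow> position ds is < prod_list ds"
proof (induction ds arbitrary: "is")
  case (Cons d ds)
  then obtain i js where i: "is = i # js" "i < d" "js \<in> indices ds" by (auto elim: indices_ConsE)
  then have "position ds js < prod_list ds" "(i + 1) * prod_list ds \<le> d * prod_list ds"
    using Cons.IH by (blast, intro mult_le_mono1) simp
  then show ?case using i by simp
qed simp

lemma position_append:
  "length is = length ds \<Longrightarrow>
    position (ds @ es) (is @ js) = position ds is * prod_list es + position es js"
proof (induction ds arbitrary: "is")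
  case (Cons d ds)
  then show ?case by (cases "is") (auto simp: algebra_simps)
qed simp

lemma row_major_position: "is \<in> indices ds \<Longrightarrow> row_major ds (position ds is) = is"
proof (induction ds arbitrary: "is")
  case (Cons d ds)
  then obtain i js where i: "is = i # js" "i < d" "js \<in> indices ds" by (auto elim: indices_ConsE)
  then show ?case using Cons.IH[OF i(3)] position_less[OF i(3)] by simp
qed simp

lemma row_major_indices: "n < prod_list ds \<Longrightarrow> row_major ds n \<in> indices ds"
proof (induction ds arbitrary: n)
  case (Cons d ds)
  then have "0 < prod_list ds" by (auto intro: Nat.gr0I)
  then show ?case using Cons by (simp add: less_mult_imp_div_less)
qed simp

lemma position_row_major: "n < prod_list ds \<Longrightarrow> position ds (row_major ds n) = n"
proof (induction ds arbitrary: n)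
  case (Cons d ds)
  then have "0 < prod_list ds" by (auto intro: Nat.gr0I)
  then show ?case using Cons by simp
qed simp

text \<open>
  Splitting the modes into two groups splits the position into a quotient and a remainder. This
  identifies the entries of an unfolding, and it is what makes prefixes and suffixes accessible to
  arithmetic.
\<close>

lemma row_major_append:
  assumes "i < prod_list ds" "j < prod_list es"
  shows "row_major (ds @ es) (i * prod_list es + j) = row_major ds i @ row_major es j"
proof -
  have "row_major ds i @ row_major es j = row_major (ds @ es) (position (ds @ es) (row_major ds i @ row_major es j))"
    using assms by (intro row_major_position[symmetric])
      (auto simp: indices_def nth_append dest!: row_major_indices)
  then show ?thesis
    using assms by (simp add: position_append position_row_major indices_length[OF row_major_indices])
qed

lemma vectorise_dim [simp]: "dim_vec (vectorise T) = prod_list (dims T)"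
  by (simp add: vectorise_def)

lemma vectorise_index: "n < prod_list (dims T) \<Longrightarrow> vectorise T $ n = entry T (row_major (dims T) n)"
  by (simp add: vectorise_def)

lemma entry_eq_vectorise: "is \<in> indices (dims T) \<Longrightarrow> entry T is = vectorise T $ position (dims T) is"
  by (simp add: vectorise_index position_less row_major_position)

lemma sparse_vectorise:
  "sparse R T \<longleftrightarrow> card {n. n < prod_list (dims T) \<and> vectorise T $ n \<noteq> 0} = R"
proof -
  have "bij_betw (position (dims T)) {is \<in> indices (dims T). entry T is \<noteq> 0}
     {n. n < prod_list (dims T) \<and> vectorise T $ n \<noteq> 0}"
    by (rule bij_betw_byWitness[where f' = "row_major (dims T)"])
      (auto simp: row_major_position position_row_major row_major_indices position_less vectorise_index)
  then show ?thesis by (simp add: sparse_def bij_betw_same_card)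
qed

lemma unfold_dim [simp]:
  "dim_row (unfold k T) = prod_list (take k (dims T))"
  "dim_col (unfold k T) = prod_list (drop k (dims T))"
  by (simp_all add: unfold_def Let_def)

lemma unfold_index:
  assumes "i < prod_list (take k (dims T))" "j < prod_list (drop k (dims T))"
  shows "unfold k T $$ (i, j) =
    entry T (row_major (take k (dims T)) i @ row_major (drop k (dims T)) j)"
proof -
  let ?m = "prod_list (take k (dims T))" and ?n = "prod_list (drop k (dims T))"
  have "(i + 1) * ?n \<le> ?m * ?n" using assms by (intro mult_right_mono) auto
  moreover have "prod_list (dims T) = ?m * ?n"
    by (metis append_take_drop_id prod_list.append)
  ultimately have "i * ?n + j < prod_list (dims T)" using assms by simp
  then have "unfold k T $$ (i, j) = entry T (row_major (take k (dims T) @ drop k (dims T)) (i * ?n + j))"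
    using assms by (simp add: unfold_def Let_def vectorise_index)
  then show ?thesis by (simp only: row_major_append[OF assms])
qed

section \<open>Selection matrices\<close>

definition selection_mat :: "nat \<Rightarrow> nat \<Rightarrow> (nat \<Rightarrow> nat) \<Rightarrow> real mat" where
  "selection_mat m n f = mat m n (\<lambda>(i, j). of_bool (i = f j))"

lemma selection_mat_dim [simp]: "dim_row (selection_mat m n f) = m" "dim_col (selection_mat m n f) = n"
  by (simp_all add: selection_mat_def)

lemma selection_mat_index: "i < m \<Longrightarrow> j < n \<Longrightarrow> selection_mat m n f $$ (i, j) = of_bool (i = f j)"
  by (simp add: selection_mat_def)

lemma selection_mat_col:
  assumes "j < n" "f j < m" shows "col (selection_mat m n f) j = unit_vec m (f j)"
  using assms by (intro eq_vecI) (auto simp: selection_mat_def unit_vec_def)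

lemma selection_mat_orthogonal:
  assumes "inj_on f {..<n}" "f ` {..<n} \<subseteq> {..<m}"
  shows "transpose_mat (selection_mat m n f) * selection_mat m n f = 1\<^sub>m n"
proof (rule eq_matI)
  fix i j assume "i < dim_row (1\<^sub>m n :: real mat)" "j < dim_col (1\<^sub>m n :: real mat)"
  then have ij: "i < n" "j < n" "f i < m" "f j < m" using assms(2) by auto
  then have "(transpose_mat (selection_mat m n f) * selection_mat m n f) $$ (i, j) =
     unit_vec m (f i) \<bullet> unit_vec m (f j)"
    by (simp add: selection_mat_col)
  also have "\<dots> = 1\<^sub>m n $$ (i, j)"
    using ij assms(1) by (auto simp: inj_on_def)
  finally show "(transpose_mat (selection_mat m n f) * selection_mat m n f) $$ (i, j) = 1\<^sub>m n $$ (i, j)" .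
qed auto

text \<open>
  Reading \<open>v\<close> along \<open>f\<close> and writing the values back loses only entries outside the range of \<open>f\<close>, and these
  are zero.
\<close>

lemma selection_mat_mult_vec:
  assumes "inj_on f {..<n}" "f ` {..<n} \<subseteq> {..<m}" "dim_vec v = m"
    and "\<And>i. i < m \<Longrightarrow> v $ i \<noteq> 0 \<Longrightarrow> i \<in> f ` {..<n}"
  shows "selection_mat m n f *\<^sub>v vec n (\<lambda>j. v $ f j) = v"
proof (rule eq_vecI)
  fix i assume i: "i < dim_vec v"
  have "(selection_mat m n f *\<^sub>v vec n (\<lambda>j. v $ f j)) $ i =
     (\<Sum>j\<in>{..<n}. of_bool (f j = i) * v $ f j)"
    unfolding index_mult_mat_vec[of i "selection_mat m n f", simplified selection_mat_dim, OF i[unfolded assms(3)]]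
    by (simp only: scalar_prod_def dim_vec atLeast0LessThan, intro sum.cong)
      (use i assms(3) in \<open>auto simp: selection_mat_index\<close>)
  also have "\<dots> = (\<Sum>x\<in>f ` {..<n}. of_bool (x = i) * v $ x)"
    using sum.reindex[OF assms(1), of "\<lambda>x. of_bool (x = i) * v $ x"] by (simp only: comp_def)
  also have "\<dots> = (if i \<in> f ` {..<n} then v $ i else 0)"
    by (subst sum.delta[symmetric]) (auto intro!: sum.cong)
  also have "\<dots> = v $ i" using assms(3,4) i by auto
  finally show "(selection_mat m n f *\<^sub>v vec n (\<lambda>j. v $ f j)) $ i = v $ i" .
qed (simp add: assms(3))

text \<open>
  The weights may be \<open>\<infinity>\<close>, which is harmless because a zero of the matrix annihilates it.
\<close>

lemma transpose_selection_mat_mult_vec: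
  assumes "f ` {..<n} \<subseteq> {..<m}" "dim_vec w = m"
  shows "transpose_mat (map_mat ennreal (selection_mat m n f)) *\<^sub>v w = vec n (\<lambda>j. w $ f j)"
proof (rule eq_vecI)
  fix j assume "j < dim_vec (vec n (\<lambda>j. w $ f j))"
  then have j: "j < n" "f j < m" using assms(1) by auto
  have "(transpose_mat (map_mat ennreal (selection_mat m n f)) *\<^sub>v w) $ j =
    (\<Sum>i<m. ennreal (of_bool (i = f j)) * w $ i)"
    using j assms(2) by (simp add: scalar_prod_def selection_mat_index atLeast0LessThan)
  also have "\<dots> = (\<Sum>i<m. if f j = i then w $ i else 0)"
    by (intro sum.cong) auto
  also have "\<dots> = w $ f j" using j by simp
  finally show "(transpose_mat (map_mat ennreal (selection_mat m n f)) *\<^sub>v w) $ j = vec n (\<lambda>j. w $ f j) $ j"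
    using j by simp
qed simp

lemma one_mat_selection: "1\<^sub>m d = selection_mat d d (\<lambda>i. i)"
  by (rule eq_matI) (auto simp: selection_mat_index)

text \<open>
  An equation between a number and \<open>x * p + y\<close> with \<open>y < p\<close> amounts to one equation for the quotient
  and one for the remainder, which are what the two factors test.
\<close>

lemma kronecker_selection_mat:
  assumes "g ` {..<q} \<subseteq> {..<p}"
  shows "selection_mat m n f \<otimes>\<^sub>K selection_mat p q g =
    selection_mat (m * p) (n * q) (\<lambda>j. f (j div q) * p + g (j mod q))"
proof (rule eq_matI)
  fix i j assume "i < dim_row (selection_mat (m * p) (n * q) (\<lambda>j. f (j div q) * p + g (j mod q)))"
    and "j < dim_col (selection_mat (m * p) (n * q) (\<lambda>j. f (j div q) * p + g (j mod q)))"
  then have ij: "i < m * p" "j < n * q" by auto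
  then have pq: "0 < p" "0 < q" by (auto intro: Nat.gr0I)
  then have "j mod q < q" by simp
  then have g: "g (j mod q) < p" using assms by blast
  have "i div p = f (j div q) \<and> i mod p = g (j mod q) \<longleftrightarrow> i = f (j div q) * p + g (j mod q)"
    using div_mod_unique[OF g] by simp
  then show "(selection_mat m n f \<otimes>\<^sub>K selection_mat p q g) $$ (i, j) =
     selection_mat (m * p) (n * q) (\<lambda>j. f (j div q) * p + g (j mod q)) $$ (i, j)"
    using ij pq by (auto simp: kronecker_def selection_mat_index less_mult_imp_div_less)
qed (auto simp: kronecker_def)

text \<open>
  The map compares first by the quotient and then by the remainder, that is, lexicographically.
\<close>

lemma strict_mono_on_kronecker:
  fixes f g :: "nat \<Rightarrow> nat"
  assumes f: "strict_mono_on {..<n} f" and g: "strict_mono_on {..<q} g" "g ` {..<q} \<subseteq> {..<p}"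
  shows "strict_mono_on {..<n * q} (\<lambda>j. f (j div q) * p + g (j mod q))"
proof (rule strict_mono_onI)
  fix i j assume ij: "i \<in> {..<n * q}" "j \<in> {..<n * q}" "i < j"
  then have q: "0 < q" by (auto intro: Nat.gr0I)
  have d: "i div q < n" "j div q < n" "i div q \<le> j div q" "i mod q < q" "j mod q < q"
    using ij q by (auto simp: less_mult_imp_div_less intro: div_le_mono)
  have gi: "g (i mod q) < p" using d g(2) by blast
  show "f (i div q) * p + g (i mod q) < f (j div q) * p + g (j mod q)"
  proof (cases "i div q = j div q")
    case True
    then have "i mod q < j mod q" using ij(3) by (metis div_mult_mod_eq nat_add_left_cancel_less)
    then show ?thesis using g(1) d True by (auto simp: strict_mono_on_def)
  next
    case False
    then have "f (i div q) < f (j div q)" using f d by (auto simp: strict_mono_on_def)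
    then have "(f (i div q) + 1) * p \<le> f (j div q) * p" by (intro mult_right_mono) auto
    then show ?thesis using gi by (simp add: algebra_simps)
  qed
qed

lemma kronecker_image_le:
  fixes f g :: "nat \<Rightarrow> nat"
  assumes "f ` {..<n} \<subseteq> {..<m}" "g ` {..<q} \<subseteq> {..<p}"
  shows "(\<lambda>j. f (j div q) * p + g (j mod q)) ` {..<n * q} \<subseteq> {..<m * p}"
proof
  fix x assume "x \<in> (\<lambda>j. f (j div q) * p + g (j mod q)) ` {..<n * q}"
  then obtain j where j: "j < n * q" "x = f (j div q) * p + g (j mod q)" by auto
  then have "0 < q" by (auto intro: Nat.gr0I)
  then have "j mod q < q" "j div q < n" using j by (auto simp: less_mult_imp_div_less)
  then have "g (j mod q) < p" "f (j div q) + 1 \<le> m" using assms by fastforce+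
  then have "x < (f (j div q) + 1) * p" "(f (j div q) + 1) * p \<le> m * p" using j
    by (simp, intro mult_right_mono) auto
  then show "x \<in> {..<m * p}" by auto
qed

text \<open>
  Both \<open>map f [0..<n]\<close> and the list of all positions in the range of \<open>f\<close> enumerate this range in
  strictly increasing order, so they are equal; and filtering a list leaves a subsequence of it.
\<close>

lemma subseq_map_nth_strict_mono:
  assumes "strict_mono_on {..<n} f" "f ` {..<n} \<subseteq> {..<length xs}"
  shows "subseq (map (\<lambda>j. xs ! f j) [0..<n]) xs"
proof -
  have "map f [0..<n] = filter (\<lambda>i. i \<in> f ` {..<n}) [0..<length xs]"
  proof (rule strict_sorted_equal)
    show "sorted_wrt (<) (map f [0..<n])"
      using assms(1) by (auto simp: sorted_wrt_iff_nth_less strict_mono_on_def)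
    show "sorted_wrt (<) (filter (\<lambda>i. i \<in> f ` {..<n}) [0..<length xs])"
      by (intro sorted_wrt_filter) simp
    show "set (map f [0..<n]) = set (filter (\<lambda>i. i \<in> f ` {..<n}) [0..<length xs])"
      using assms(2) by (auto simp: image_subset_iff)
  qed
  then have "subseq (map f [0..<n]) [0..<length xs]" by simp
  then have "subseq (map ((!) xs) (map f [0..<n])) (map ((!) xs) [0..<length xs])"
    by (rule subseq_map)
  then show ?thesis by (simp add: map_nth comp_def)
qed

text \<open>
  Each of the three kinds of norm is a sum or a supremum of terms that vanish where \<open>v\<close> does, so
  it may be restricted to any set that contains the support of \<open>v\<close>.
\<close>

lemma weighted_norm_selection:
  assumes inj: "inj_on f {..<n}" and im: "f ` {..<n} \<subseteq> {..<m}" and dim: "dim_vec v = m"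
    and supp: "\<And>i. i < m \<Longrightarrow> v $ i \<noteq> 0 \<Longrightarrow> i \<in> f ` {..<n}"
  shows "weighted_norm q w v = weighted_norm q (vec n (\<lambda>j. w $ f j)) (vec n (\<lambda>j. v $ f j))"
proof -
  have sum: "(\<Sum>i<m. F i) = (\<Sum>j<n. F (f j))" if "\<And>i. i < m \<Longrightarrow> v $ i = 0 \<Longrightarrow> F i = 0" for F :: "nat \<Rightarrow> ennreal"
  proof -
    have "(\<Sum>j<n. F (f j)) = (\<Sum>i\<in>f ` {..<n}. F i)" using inj by (simp add: sum.reindex)
    also have "\<dots> = (\<Sum>i<m. F i)" using im supp that by (intro sum.mono_neutral_left) auto
    finally show ?thesis by simp
  qed
  consider "q = 0" | "q = \<infinity>" "q \<noteq> 0" | "q \<noteq> 0" "q \<noteq> \<infinity>" by blast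
  then show ?thesis
  proof cases
    case 1
    have "(\<Sum>j | j < m \<and> v $ j \<noteq> 0. (w $ j)\<^sup>2) = (\<Sum>j<m. if v $ j \<noteq> 0 then (w $ j)\<^sup>2 else 0)"
      by (simp add: sum.If_cases Collect_conj_eq lessThan_def)
    also have "\<dots> = (\<Sum>j<n. if v $ f j \<noteq> 0 then (w $ f j)\<^sup>2 else 0)"
      by (rule sum) auto
    also have "\<dots> = (\<Sum>j | j < n \<and> v $ f j \<noteq> 0. (w $ f j)\<^sup>2)"
      by (simp add: sum.If_cases Collect_conj_eq lessThan_def)
    also have "\<dots> = (\<Sum>j | j < n \<and> vec n (\<lambda>j. v $ f j) $ j \<noteq> 0. (vec n (\<lambda>j. w $ f j) $ j)\<^sup>2)"
      by (intro sum.cong) auto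
    finally show ?thesis using 1 dim by (simp add: weighted_norm_def)
  next
    case 2
    let ?F = "\<lambda>j. w $ j * ennreal \<bar>v $ j\<bar>"
    have "(SUP j\<in>{..<m}. ?F j) \<le> (SUP j\<in>{..<n}. ?F (f j))"
    proof (rule SUP_least)
      fix i assume i: "i \<in> {..<m}"
      show "?F i \<le> (SUP j\<in>{..<n}. ?F (f j))"
      proof (cases "v $ i = 0")
        case False
        then obtain j where "j < n" "i = f j" using supp i by blast
        then show ?thesis by (auto intro: SUP_upper)
      qed simp
    qed
    moreover have "(SUP j\<in>{..<n}. ?F (f j)) \<le> (SUP j\<in>{..<m}. ?F j)"
      using im by (intro SUP_least SUP_upper) auto
    ultimately have "(SUP j\<in>{..<m}. ?F j) = (SUP j\<in>{..<n}. ?F (f j))" by (rule antisym)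
    then show ?thesis using 2 dim by (simp add: weighted_norm_def cong: SUP_cong_simp)
  next
    case 3
    then show ?thesis using dim
      by (simp add: weighted_norm_def sum ennpow_def)
  qed
qed

section \<open>Contractions of several tensors\<close>

lemma chain_Cons: "Ts \<noteq> [] \<Longrightarrow> chain (T # Ts) = T \<circ>\<^sub>t chain Ts"
  by (cases Ts) auto

lemma dims_chain:
  assumes "\<forall>j \<in> {a..<b}. dims (W j) = [r (j - 1), d j, r j]" "a \<le> b" "a = b \<Longrightarrow> r (a - 1) = 1"
  shows "dims (chain (map W [a..<b])) = r (a - 1) # map d [a..<b] @ [r (b - 1)]"
  using assms(2,1,3)
proof (induction rule: inc_induct)
  case base
  then show ?case by simp
next
  case (step n)
  show ?case
  proof (cases "Suc n = b")
    case True
    then have b: "b = Suc n" by simp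
    show ?thesis using step.prems(1) by (simp add: b)
  next
    case False
    then have "Suc n < b" using step.hyps by simp
    moreover have "dims (chain (map W [Suc n..<b])) = r n # map d [Suc n..<b] @ [r (b - 1)]"
      using step.IH step.prems False by simp
    ultimately show ?thesis
      using step.prems step.hyps by (simp add: upt_conv_Cons[of n] chain_Cons contract_def)
  qed
qed

text \<open>
  The case of an empty \<open>Ts\<close> is included so that inductions can start there: the scalar 1 acts as a neutral
  element, provided that the last mode of \<open>T\<close> is a boundary mode of size 1.
\<close>

lemma entry_chain_Cons:
  assumes "Ts \<noteq> [] \<or> (q = 1 \<and> rest = [0])" "dims T = [p, d, q]"
  shows "entry (chain (T # Ts)) (a # i # rest) = (\<Sum>c<q. entry T [a, i, c] * entry (chain Ts) (c # rest))"
  using assms by (cases Ts) (auto simp: contract_def)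

lemma last_dims_chain_Cons:
  assumes "Us \<noteq> []" "\<forall>T\<in>set Us. length (dims T) = 3"
  shows "1 < length (dims (chain Us)) \<and> last (dims (chain (T # Us))) = last (dims (chain Us))"
proof -
  have "1 < length (dims (chain Us))" using assms
  proof (induction Us)
    case (Cons U Us)
    then show ?case by (cases "Us = []") (auto simp: chain_Cons contract_def)
  qed simp
  then show ?thesis using assms(1)
    by (cases "dims (chain Us)") (auto simp: chain_Cons contract_def Let_def)
qed

text \<open>
  Contraction is associative. Contractions are nested to the right, so this is needed to split off
  the modes to the right of any position. For an empty \<open>Us\<close>, the multi-index \<open>pre\<close> consists only of
  the index 0 of the boundary mode.
\<close>

lemma entry_chain_append:
  assumes "\<forall>T\<in>set Us. length (dims T) = 3" "Ws \<noteq> []"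
    and "length pre = length Us + 1" "Us = [] \<Longrightarrow> pre = [0]"
  shows "entry (chain (Us @ Ws)) (pre @ rest) =
    (\<Sum>b<last (dims (chain Us)). entry (chain Us) (pre @ [b]) * entry (chain Ws) (b # rest))"
  using assms(1,3,4)
proof (induction Us arbitrary: pre)
  case Nil
  then show ?case by simp
next
  case (Cons T Us)
  obtain p d q where T: "dims T = [p, d, q]" using Cons.prems(1)
    by (auto simp: length_Suc_conv numeral_3_eq_3)
  obtain a i js where pre: "pre = a # i # js" "length js = length Us"
    using Cons.prems(2) by (auto simp: length_Suc_conv)
  show ?case
  proof (cases "Us = []")
    case True
    then show ?thesis using T pre assms(2) by (simp add: entry_chain_Cons)
  next
    case False
    have L: "last (dims (chain (T # Us))) = last (dims (chain Us))"
      using last_dims_chain_Cons False Cons.prems(1) by auto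
    have "entry (chain ((T # Us) @ Ws)) (pre @ rest) =
      (\<Sum>c<q. entry T [a, i, c] * entry (chain (Us @ Ws)) ((c # js) @ rest))"
      using entry_chain_Cons[of "Us @ Ws"] T False pre(1) by simp
    also have "\<dots> = (\<Sum>c<q. \<Sum>b<last (dims (chain Us)).
        entry T [a, i, c] * (entry (chain Us) (c # js @ [b]) * entry (chain Ws) (b # rest)))"
      using Cons.IH[of "_ # js"] Cons.prems(1) pre(2) False by (simp add: sum_distrib_left)
    also have "\<dots> = (\<Sum>b<last (dims (chain Us)). \<Sum>c<q.
        entry T [a, i, c] * (entry (chain Us) (c # js @ [b]) * entry (chain Ws) (b # rest)))"
      by (rule sum.swap)
    also have "\<dots> = (\<Sum>b<last (dims (chain (T # Us))).
        entry (chain (T # Us)) (pre @ [b]) * entry (chain Ws) (b # rest))"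
      using T False pre(1) by (simp add: L entry_chain_Cons sum_distrib_right mult.assoc)
    finally show ?thesis .
  qed
qed

text \<open>
  The representation as a linear function of its core: the coefficients are products of entries of the
  two outer contractions, which are the matrices that occur in the operator \<open>Q\<close>.
\<close>

lemma entry_train:
  assumes Us: "\<And>U. U \<in> set Us \<Longrightarrow> length (dims U) = 3" "last (dims (chain Us)) = p"
    and C: "dims C = [p, d, q]" and js: "length js = length Us"
    and Vs: "Vs = [] \<Longrightarrow> q = 1 \<and> ks = []"
  shows "entry (chain (Us @ [C] @ Vs)) ([0] @ (js @ i # ks) @ [0]) =
    (\<Sum>a<p. \<Sum>b<q. entry (chain Us) (0 # js @ [a]) * (entry C [a, i, b] * entry (chain Vs) (b # ks @ [0])))"
proof -
  have "entry (chain (Us @ [C] @ Vs)) ((0 # js) @ (i # ks @ [0])) =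
    (\<Sum>a<p. entry (chain Us) ((0 # js) @ [a]) * entry (chain ([C] @ Vs)) (a # i # ks @ [0]))"
    unfolding Us(2)[symmetric] using Us(1) js by (intro entry_chain_append) auto
  also have "\<dots> = (\<Sum>a<p. \<Sum>b<q. entry (chain Us) (0 # js @ [a]) *
      (entry C [a, i, b] * entry (chain Vs) (b # ks @ [0])))"
    using Vs by (auto simp: entry_chain_Cons[OF _ C] sum_distrib_left intro!: sum.cong)
  finally show ?thesis by simp
qed

section \<open>Cores with orthogonal unfoldings\<close>

text \<open>
  The unfolding is a selection matrix: column \<open>b\<close> has its only 1 in row \<open>f b\<close>. Injectivity of
  \<open>f\<close> is orthogonality of the columns, and the number of columns is the number of non-zero entries.
\<close>

lemma left_selecting_core:
  assumes dims: "dims T = [p, d, q]"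
    and entry: "\<And>a i b. a < p \<Longrightarrow> i < d \<Longrightarrow> b < q \<Longrightarrow> entry T [a, i, b] = of_bool (a * d + i = f b)"
    and inj: "inj_on f {..<q}" and im: "f ` {..<q} \<subseteq> {..<p * d}"
  shows "binary T \<and> left_orthogonal T \<and> sparse q T"
proof (intro conjI)
  show "binary T" unfolding binary_def dims
    by (auto elim!: indices_tripleE simp: entry)
  have "unfold 2 T = selection_mat (p * d) q f"
  proof (rule eq_matI)
    fix n b assume "n < dim_row (selection_mat (p * d) q f)" "b < dim_col (selection_mat (p * d) q f)"
    then have nb: "n < p * d" "b < q" by auto
    then have "0 < d" by (auto intro: Nat.gr0I)
    then show "unfold 2 T $$ (n, b) = selection_mat (p * d) q f $$ (n, b)"
      using nb by (simp add: unfold_index dims entry less_mult_imp_div_less selection_mat_index)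
  qed (auto simp: dims)
  then show "left_orthogonal T"
    using selection_mat_orthogonal[OF inj im] by (simp add: left_orthogonal_def Let_def dims numeral_2_eq_2)
  \<comment> \<open>the unit entry in column \<open>b\<close>, folded back to a multi-index\<close>
  have "{is \<in> indices (dims T). entry T is \<noteq> 0} = (\<lambda>b. [f b div d, f b mod d, b]) ` {..<q}"
  proof (intro equalityI subsetI)
    fix "is" assume "is \<in> {is \<in> indices (dims T). entry T is \<noteq> 0}"
    then obtain a i b where *: "is = [a, i, b]" "a < p" "i < d" "b < q" "entry T is \<noteq> 0"
      by (auto simp: dims elim: indices_tripleE)
    then have "f b = a * d + i" by (auto simp: entry)
    then show "is \<in> (\<lambda>b. [f b div d, f b mod d, b]) ` {..<q}"
      using * by (intro image_eqI[of _ _ b]) auto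
  next
    fix "is" assume "is \<in> (\<lambda>b. [f b div d, f b mod d, b]) ` {..<q}"
    then obtain b where b: "b < q" "is = [f b div d, f b mod d, b]" by auto
    then have f: "f b < p * d" using im by auto
    then have "0 < d" by (auto intro: Nat.gr0I)
    then show "is \<in> {is \<in> indices (dims T). entry T is \<noteq> 0}"
      using b f by (simp add: dims entry less_mult_imp_div_less)
  qed
  then show "sparse q T" by (simp add: sparse_def card_image inj_on_def)
qed

lemma right_selecting_core:
  assumes dims: "dims T = [p, d, q]"
    and entry: "\<And>a i b. a < p \<Longrightarrow> i < d \<Longrightarrow> b < q \<Longrightarrow> entry T [a, i, b] = of_bool (i * q + b = f a)"
    and inj: "inj_on f {..<p}" and im: "f ` {..<p} \<subseteq> {..<d * q}"
  shows "binary T \<and> right_orthogonal T \<and> sparse p T"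
proof (intro conjI)
  show "binary T" unfolding binary_def dims
    by (auto elim!: indices_tripleE simp: entry)
  have "unfold 1 T = transpose_mat (selection_mat (d * q) p f)"
  proof (rule eq_matI)
    fix a n assume "a < dim_row (transpose_mat (selection_mat (d * q) p f))"
      "n < dim_col (transpose_mat (selection_mat (d * q) p f))"
    then have an: "a < p" "n < d * q" by auto
    then have "0 < q" by (auto intro: Nat.gr0I)
    then show "unfold 1 T $$ (a, n) = transpose_mat (selection_mat (d * q) p f) $$ (a, n)"
      using an by (simp add: unfold_index dims entry less_mult_imp_div_less selection_mat_index)
  qed (auto simp: dims)
  then show "right_orthogonal T"
    using selection_mat_orthogonal[OF inj im] by (simp add: right_orthogonal_def Let_def dims)
  have "{is \<in> indices (dims T). entry T is \<noteq> 0} = (\<lambda>a. [a, f a div q, f a mod q]) ` {..<p}"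
  proof (intro equalityI subsetI)
    fix "is" assume "is \<in> {is \<in> indices (dims T). entry T is \<noteq> 0}"
    then obtain a i b where *: "is = [a, i, b]" "a < p" "i < d" "b < q" "entry T is \<noteq> 0"
      by (auto simp: dims elim: indices_tripleE)
    then have "f a = i * q + b" by (auto simp: entry)
    then show "is \<in> (\<lambda>a. [a, f a div q, f a mod q]) ` {..<p}" using * by auto
  next
    fix "is" assume "is \<in> (\<lambda>a. [a, f a div q, f a mod q]) ` {..<p}"
    then obtain a where a: "a < p" "is = [a, f a div q, f a mod q]" by auto
    then have f: "f a < d * q" using im by auto
    then have "0 < q" by (auto intro: Nat.gr0I)
    then show "is \<in> {is \<in> indices (dims T). entry T is \<noteq> 0}"
      using a f by (simp add: dims entry less_mult_imp_div_less)
  qed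
  then show "sparse p T" by (simp add: sparse_def card_image inj_on_def)
qed

text \<open>
  The element of \<open>S\<close> with exactly \<open>i\<close> smaller elements. It has to be the increasing enumeration for \<open>\<beta>\<close>
  to be a subsequence of \<open>\<omega>\<close>.
\<close>

definition enum :: "nat set \<Rightarrow> nat \<Rightarrow> nat" where
  "enum S i = sorted_list_of_set S ! i"

lemma enum_strict_mono: "finite S \<Longrightarrow> strict_mono_on {..<card S} (enum S)"
  by (auto simp: strict_mono_on_def enum_def intro!: sorted_wrt_nth_less[OF strict_sorted_list_of_set])

lemma bij_betw_enum: "finite S \<Longrightarrow> bij_betw (enum S) {..<card S} S"
  unfolding enum_def by (rule bij_betw_nth) auto

lemma enum_in: "finite S \<Longrightarrow> c < card S \<Longrightarrow> enum S c \<in> S"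
  using bij_betw_enum[of S] by (auto simp: bij_betw_def)

lemma enum_onto: "finite S \<Longrightarrow> x \<in> S \<Longrightarrow> \<exists>c < card S. enum S c = x"
  using bij_betw_enum[of S] by (force simp: bij_betw_def)

lemma sum_enum: "finite S \<Longrightarrow> (\<Sum>c<card S. g (enum S c)) = (\<Sum>x\<in>S. g x)"
  by (rule sum.reindex_bij_betw[OF bij_betw_enum])

lemma enum_singleton [simp]: "enum {x} 0 = x" by (simp add: enum_def)

lemma enum_eq_iff: "finite S \<Longrightarrow> a < card S \<Longrightarrow> b < card S \<Longrightarrow> enum S a = enum S b \<longleftrightarrow> a = b"
  using bij_betw_enum[of S] by (auto simp: bij_betw_def inj_on_def)

lemma enum_inverse:
  assumes "finite S"
  obtains g where "\<And>x. x \<in> S \<Longrightarrow> g x < card S" "\<And>x. x \<in> S \<Longrightarrow> enum S (g x) = x"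
  using enum_onto[OF assms] by metis

text \<open>
  Appending an index \<open>i < d\<close> to a multi-index at position \<open>n\<close> leads to position \<open>n * d + i\<close>. Thus
  the core tests whether the prefix \<open>b\<close> in \<open>S'\<close> extends the prefix \<open>a\<close> in \<open>S\<close> by \<open>i\<close>.
\<close>

definition prefix_core :: "nat \<Rightarrow> nat set \<Rightarrow> nat set \<Rightarrow> real tensor" where
  "prefix_core d S S' = Tensor [card S, d, card S']
    (\<lambda>is. of_bool (enum S' (is ! 2) = enum S (is ! 0) * d + is ! 1))"

lemma prefix_core_simps [simp]:
  "dims (prefix_core d S S') = [card S, d, card S']"
  "entry (prefix_core d S S') [a, i, b] = of_bool (enum S' b = enum S a * d + i)"
  by (simp_all add: prefix_core_def)

text \<open>
  Here an index \<open>i\<close> is put in front of a suffix, whose modes admit \<open>N\<close> multi-indices.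
\<close>

definition suffix_core :: "nat \<Rightarrow> nat \<Rightarrow> nat set \<Rightarrow> nat set \<Rightarrow> real tensor" where
  "suffix_core d N T T' = Tensor [card T, d, card T']
    (\<lambda>is. of_bool (enum T (is ! 0) = is ! 1 * N + enum T' (is ! 2)))"

lemma suffix_core_simps [simp]:
  "dims (suffix_core d N T T') = [card T, d, card T']"
  "entry (suffix_core d N T T') [a, i, b] = of_bool (enum T a = i * N + enum T' b)"
  by (simp_all add: suffix_core_def)

text \<open>
  The map \<open>n \<mapsto> (n div d, n mod d)\<close> is injective. It stays so if the quotient, which is in \<open>S\<close>, is replaced
  by its rank in \<open>S\<close>.
\<close>

lemma prefix_core_frame:
  assumes fin: "finite S" "finite S'" and S': "\<And>n. n \<in> S' \<Longrightarrow> n div d \<in> S" "\<And>n. n \<in> S' \<Longrightarrow> 0 < d"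
  shows "binary (prefix_core d S S') \<and> left_orthogonal (prefix_core d S S') \<and>
    sparse (card S') (prefix_core d S S')"
proof -
  obtain g where g: "\<And>x. x \<in> S \<Longrightarrow> g x < card S" "\<And>x. x \<in> S \<Longrightarrow> enum S (g x) = x"
    using enum_inverse[OF fin(1)] by blast
  \<comment> \<open>the row of the unfolding in which column \<open>b\<close> has its 1\<close>
  define f where "f b = g (enum S' b div d) * d + enum S' b mod d" for b
  have b: "enum S' b \<in> S'" "enum S' b div d \<in> S" "0 < d" if "b < card S'" for b
    using enum_in[OF fin(2) that] S' by auto
  show ?thesis
  proof (rule left_selecting_core)
    show "dims (prefix_core d S S') = [card S, d, card S']" by simp
  next
    fix a i b assume *: "a < card S" "i < d" "b < card S'"
    have "enum S' b = enum S a * d + i \<longleftrightarrow> enum S' b div d = enum S a \<and> enum S' b mod d = i"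
      by (rule div_mod_unique[OF *(2)])
    also have "\<dots> \<longleftrightarrow> g (enum S' b div d) = a \<and> enum S' b mod d = i"
      using g b(2)[OF *(3)] * fin by (metis enum_eq_iff)
    also have "\<dots> \<longleftrightarrow> f b = a * d + i"
      unfolding f_def using div_mod_unique[OF *(2), of "f b" a] * by (simp add: f_def)
    finally show "entry (prefix_core d S S') [a, i, b] = of_bool (a * d + i = f b)" by auto
  next
    show "inj_on f {..<card S'}"
    proof (rule inj_onI)
      fix x y assume *: "x \<in> {..<card S'}" "y \<in> {..<card S'}" "f x = f y"
      then have xy: "x < card S'" "y < card S'" by auto
      have d: "f x div d = g (enum S' x div d)" "f x mod d = enum S' x mod d"
        "f y div d = g (enum S' y div d)" "f y mod d = enum S' y mod d"
        using b(3)[OF xy(1)] by (simp_all add: f_def)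
      then have "enum S' x div d = enum S' y div d" "enum S' x mod d = enum S' y mod d"
        using g(2) b(2) xy *(3) by metis+
      then have "enum S' x = enum S' y" by (metis div_mult_mod_eq)
      then show "x = y" using enum_eq_iff[OF fin(2) xy] by simp
    qed
  next
    show "f ` {..<card S'} \<subseteq> {..<card S * d}"
    proof
      fix n assume "n \<in> f ` {..<card S'}"
      then obtain x where x: "x < card S'" "n = f x" by auto
      then have "n div d < card S" using b[OF x(1)] g by (simp add: f_def)
      then show "n \<in> {..<card S * d}" using b[OF x(1)] by (simp add: div_less_iff_less_mult)
    qed
  qed
qed

text \<open>
  Now the remainder by \<open>N\<close>, which is a shorter suffix, is replaced by its rank in \<open>T'\<close>.
\<close>

lemma suffix_core_frame:
  assumes fin: "finite T" "finite T'"
    and T: "\<And>n. n \<in> T \<Longrightarrow> n mod N \<in> T'" "\<And>n. n \<in> T \<Longrightarrow> n div N < d" and T': "T' \<subseteq> {..<N}"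
  shows "binary (suffix_core d N T T') \<and> right_orthogonal (suffix_core d N T T') \<and>
    sparse (card T) (suffix_core d N T T')"
proof -
  let ?q = "card T'"
  obtain g where g: "\<And>x. x \<in> T' \<Longrightarrow> g x < ?q" "\<And>x. x \<in> T' \<Longrightarrow> enum T' (g x) = x"
    using enum_inverse[OF fin(2)] by blast
  \<comment> \<open>the column of the unfolding in which row \<open>a\<close> has its 1\<close>
  define f where "f a = enum T a div N * ?q + g (enum T a mod N)" for a
  have a: "enum T a \<in> T" "enum T a mod N \<in> T'" "g (enum T a mod N) < ?q" "enum T a div N < d"
    if "a < card T" for a
    using enum_in[OF fin(1) that] T g by auto
  have f: "f a div ?q = enum T a div N" "f a mod ?q = g (enum T a mod N)" if "a < card T" for a
    using a(3)[OF that] by (simp_all add: f_def)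
  show ?thesis
  proof (rule right_selecting_core)
    show "dims (suffix_core d N T T') = [card T, d, card T']" by simp
  next
    fix a i b assume *: "a < card T" "i < d" "b < ?q"
    have "enum T' b < N" using enum_in[OF fin(2) *(3)] T' by auto
    then have "enum T a = i * N + enum T' b \<longleftrightarrow> enum T a div N = i \<and> enum T a mod N = enum T' b"
      by (rule div_mod_unique)
    also have "\<dots> \<longleftrightarrow> enum T a div N = i \<and> g (enum T a mod N) = b"
      using g a(2)[OF *(1)] * fin by (metis enum_eq_iff)
    also have "\<dots> \<longleftrightarrow> f a = i * ?q + b"
      unfolding div_mod_unique[OF *(3)] f[OF *(1)] ..
    finally show "entry (suffix_core d N T T') [a, i, b] = of_bool (i * ?q + b = f a)" by auto
  next
    show "inj_on f {..<card T}"
    proof (rule inj_onI)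
      fix x y assume *: "x \<in> {..<card T}" "y \<in> {..<card T}" "f x = f y"
      then have xy: "x < card T" "y < card T" by auto
      then have "enum T x div N = enum T y div N" "enum T x mod N = enum T y mod N"
        using g(2) a(2) f *(3) by metis+
      then have "enum T x = enum T y" by (metis div_mult_mod_eq)
      then show "x = y" using enum_eq_iff[OF fin(1) xy] by simp
    qed
  next
    show "f ` {..<card T} \<subseteq> {..<d * ?q}"
    proof
      fix n assume "n \<in> f ` {..<card T}"
      then obtain x where x: "x < card T" "n = f x" by auto
      have "0 < ?q" using a(3)[OF x(1)] by simp
      moreover have "n div ?q < d" using f[OF x(1)] a[OF x(1)] x by simp
      ultimately show "n \<in> {..<d * ?q}" by (simp add: div_less_iff_less_mult)
    qed
  qed
qed

section \<open>Contracting prefix and suffix cores\<close>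

text \<open>
  In the sum over the ranks of shorter prefixes, the only candidate is the prefix given by the
  multi-index itself. If that prefix is missing from \<open>S (k - 1)\<close>, then none of its extensions is in \<open>S k\<close>, because the
  sets are closed under dropping the last index; so the value 0 of the sum is then correct as well.
\<close>

lemma entry_chain_prefix:
  assumes "1 \<le> k" and S0: "S 0 = {0}" and fin: "\<And>j. j < k \<Longrightarrow> finite (S j)"
    and S: "\<And>j n. j \<in> {1..<k} \<Longrightarrow> n \<in> S j \<Longrightarrow> n div d j \<in> S (j - 1)"
    and "is \<in> indices (map d [1..<k])" "b < card (S (k - 1))"
  shows "entry (chain (map (\<lambda>j. prefix_core (d j) (S (j - 1)) (S j)) [1..<k])) (0 # is @ [b]) =
    of_bool (enum (S (k - 1)) b = position (map d [1..<k]) is)"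
  using assms(1) fin S assms(5,6)
proof (induction k arbitrary: "is" b rule: dec_induct)
  case base
  then show ?case using S0 by simp
next
  case (step k)
  let ?U = "\<lambda>j. prefix_core (d j) (S (j - 1)) (S j)"
  let ?ds = "map d [1..<k]"
  have "is \<in> indices (?ds @ [d k])" using step.prems(3) step.hyps by simp
  then obtain js i where ix: "is = js @ [i]" "js \<in> indices ?ds" "i < d k"
    by (auto elim!: indices_appendE indices_ConsE)
  have len: "length js = k - 1" using indices_length[OF ix(2)] by simp
  have fin: "finite (S (k - 1))" using step.prems(1) by simp
  let ?n = "enum (S k) b" and ?p = "position ?ds js"
  have n: "?n \<in> S k" using enum_in step.prems(1,4) by simp
  have last: "last (dims (chain (map ?U [1..<k]))) = card (S (k - 1))"
    by (subst dims_chain[where r = "\<lambda>j. card (S j)" and d = d]) (use step.hyps S0 in auto)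
  have "entry (chain (map ?U [1..<k] @ [?U k])) ((0 # js) @ [i, b]) =
    (\<Sum>c<card (S (k - 1)). entry (chain (map ?U [1..<k])) ((0 # js) @ [c]) *
       entry (chain [?U k]) (c # [i, b]))"
    unfolding last[symmetric] using len step.hyps
    by (intro entry_chain_append) auto
  also have "\<dots> = (\<Sum>c<card (S (k - 1)).
      of_bool (enum (S (k - 1)) c = ?p) * of_bool (?n = enum (S (k - 1)) c * d k + i))"
    using step.IH[OF _ _ ix(2)] step.prems(1,2) by (intro sum.cong) simp_all
  also have "\<dots> = (\<Sum>x\<in>S (k - 1). of_bool (x = ?p) * of_bool (?n = x * d k + i))"
    by (rule sum_enum[OF fin])
  also have "\<dots> = (\<Sum>x\<in>S (k - 1). if x = ?p then of_bool (?n = ?p * d k + i) else 0)"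
    by (intro sum.cong) auto
  also have "\<dots> = of_bool (?p \<in> S (k - 1) \<and> ?n = ?p * d k + i)"
    using fin by simp
  also have "?p \<in> S (k - 1) \<and> ?n = ?p * d k + i \<longleftrightarrow> ?n = ?p * d k + i"
    using step.prems(2)[of k ?n] n ix(3) step.hyps by auto
  also have "?p * d k + i = position (map d [1..<Suc k]) is"
    using step.hyps len by (simp add: ix(1) position_append)
  finally show ?case using step.hyps ix(1) by simp
qed

text \<open>
  The mirror image of \<open>entry_chain_prefix\<close>, by induction towards smaller \<open>k\<close>: the suffix sets are closed under
  dropping the first index.
\<close>

lemma entry_chain_suffix:
  assumes "k \<le> M" and TM: "T M = {0}" and fin: "\<And>j. j \<in> {k..M} \<Longrightarrow> finite (T j)"
    and N: "\<And>j. N j = prod_list (map d [Suc j..<Suc M])"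
    and T: "\<And>j n. j \<in> {k<..M} \<Longrightarrow> n \<in> T (j - 1) \<Longrightarrow> n mod N j \<in> T j"
    and "is \<in> indices (map d [Suc k..<Suc M])" "a < card (T k)"
  shows "entry (chain (map (\<lambda>j. suffix_core (d j) (N j) (T (j - 1)) (T j)) [Suc k..<Suc M]))
      (a # is @ [0]) = of_bool (enum (T k) a = position (map d [Suc k..<Suc M]) is)"
  using assms(1) fin T assms(6,7)
proof (induction k arbitrary: "is" a rule: inc_induct)
  case base
  then show ?case using TM by simp
next
  case (step k)
  let ?V = "\<lambda>j. suffix_core (d j) (N j) (T (j - 1)) (T j)"
  let ?ds = "map d [Suc (Suc k)..<Suc M]" and ?j = "Suc k"
  have upt: "[?j..<Suc M] = ?j # [Suc ?j..<Suc M]" using step.hyps by (simp add: upt_conv_Cons)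
  have "is \<in> indices (d ?j # ?ds)" using step.prems(3) by (simp add: upt del: upt_Suc)
  then obtain i js where ix: "is = i # js" "i < d ?j" "js \<in> indices ?ds"
    by (auto elim!: indices_ConsE)
  have fin: "finite (T ?j)" "finite (T k)" using step.prems(1) step.hyps by auto
  let ?n = "enum (T k) a" and ?p = "position ?ds js"
  have n: "?n mod N ?j \<in> T ?j" using enum_in[OF fin(2) step.prems(4)] step.prems(2)[of ?j] step.hyps by simp
  have p: "?p < N ?j" using position_less[OF ix(3)] N by simp
  have "entry (chain (?V ?j # map ?V [Suc ?j..<Suc M])) (a # i # js @ [0]) =
    (\<Sum>c<card (T ?j). entry (?V ?j) [a, i, c] * entry (chain (map ?V [Suc ?j..<Suc M])) (c # js @ [0]))"
  proof (rule entry_chain_Cons)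
    show "map ?V [Suc ?j..<Suc M] \<noteq> [] \<or> card (T ?j) = 1 \<and> js @ [0] = [0]"
    proof (cases "?j = M")
      case True
      then show ?thesis using TM indices_length[OF ix(3)] by simp
    qed (use step.hyps in auto)
  qed simp
  also have "\<dots> = (\<Sum>c<card (T ?j).
      of_bool (?n = i * N ?j + enum (T ?j) c) * of_bool (enum (T ?j) c = ?p))"
    using step.IH[OF _ _ ix(3)] step.prems(1,2) step.hyps
    by (intro sum.cong) (simp_all del: upt_Suc)
  also have "\<dots> = (\<Sum>x\<in>T ?j. of_bool (?n = i * N ?j + x) * of_bool (x = ?p))"
    by (rule sum_enum[OF fin(1)])
  also have "\<dots> = (\<Sum>x\<in>T ?j. if x = ?p then of_bool (?n = i * N ?j + ?p) else 0)"
    by (intro sum.cong) auto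
  also have "\<dots> = of_bool (?p \<in> T ?j \<and> ?n = i * N ?j + ?p)"
    using fin(1) by simp
  also have "?p \<in> T ?j \<and> ?n = i * N ?j + ?p \<longleftrightarrow> ?n = i * N ?j + ?p"
    using n p by auto
  also have "i * N ?j + ?p = position (map d [Suc k..<Suc M]) is"
    by (simp add: upt ix(1) N del: upt_Suc)
  finally show ?case unfolding upt by (simp add: ix(1) del: upt_Suc)
qed

lemma unfold_chain_prefix:
  assumes "1 \<le> k" and S0: "S 0 = {0}" and fin: "\<And>j. j < k \<Longrightarrow> finite (S j)"
    and S: "\<And>j n. j \<in> {1..<k} \<Longrightarrow> n \<in> S j \<Longrightarrow> n div d j \<in> S (j - 1)"
  shows "unfold k (chain (map (\<lambda>j. prefix_core (d j) (S (j - 1)) (S j)) [1..<k])) =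
    selection_mat (prod_list (map d [1..<k])) (card (S (k - 1))) (enum (S (k - 1)))"
    (is "unfold k ?X = selection_mat ?m ?n _")
proof -
  define X where "X = ?X"
  have dims: "dims X = 1 # map d [1..<k] @ [?n]"
    unfolding X_def by (subst dims_chain[where r = "\<lambda>j. card (S j)" and d = d]) (use assms(1) S0 in auto)
  have take: "take k (dims X) = 1 # map d [1..<k]" "drop k (dims X) = [?n]"
    unfolding dims using assms(1) by (simp_all add: take_Cons' drop_Cons')
  show ?thesis unfolding X_def[symmetric]
  proof (rule eq_matI)
    fix i b assume "i < dim_row (selection_mat ?m ?n (enum (S (k - 1))))"
      "b < dim_col (selection_mat ?m ?n (enum (S (k - 1))))"
    then have ib: "i < ?m" "b < ?n" by auto
    then have "unfold k X $$ (i, b) = entry X (0 # row_major (map d [1..<k]) i @ [b])"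
      by (subst unfold_index) (simp_all add: take del: upt_Suc)
    also have "\<dots> = of_bool (enum (S (k - 1)) b = position (map d [1..<k]) (row_major (map d [1..<k]) i))"
      unfolding X_def by (rule entry_chain_prefix[OF assms row_major_indices[OF ib(1)] ib(2)])
    also have "\<dots> = selection_mat ?m ?n (enum (S (k - 1))) $$ (i, b)"
      using ib by (auto simp: position_row_major selection_mat_index)
    finally show "unfold k X $$ (i, b) = selection_mat ?m ?n (enum (S (k - 1))) $$ (i, b)" .
  qed (simp_all add: take)
qed

lemma unfold_chain_suffix:
  assumes "k \<le> M" and TM: "T M = {0}" and fin: "\<And>j. j \<in> {k..M} \<Longrightarrow> finite (T j)"
    and N: "\<And>j. N j = prod_list (map d [Suc j..<Suc M])"
    and T: "\<And>j n. j \<in> {k<..M} \<Longrightarrow> n \<in> T (j - 1) \<Longrightarrow> n mod N j \<in> T j"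
  shows "transpose_mat (unfold 1 (chain (map (\<lambda>j. suffix_core (d j) (N j) (T (j - 1)) (T j)) [Suc k..<Suc M]))) =
    selection_mat (N k) (card (T k)) (enum (T k))"
    (is "transpose_mat (unfold 1 ?X) = selection_mat _ ?n _")
proof -
  define X where "X = ?X"
  let ?ds = "map d [Suc k..<Suc M]"
  have dims: "dims X = ?n # ?ds @ [1]"
    unfolding X_def by (subst dims_chain[where r = "\<lambda>j. card (T j)" and d = d]) (use assms(1) TM in auto)
  show ?thesis unfolding X_def[symmetric]
  proof (rule eq_matI)
    fix i a assume "i < dim_row (selection_mat (N k) ?n (enum (T k)))"
      "a < dim_col (selection_mat (N k) ?n (enum (T k)))"
    then have ia: "i < prod_list ?ds" "i < N k" "a < ?n" by (auto simp: N)
    have rm: "row_major (?ds @ [1]) i = row_major ?ds i @ [0]"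
      using row_major_append[of i ?ds 0 "[1]"] ia(1) by (simp del: upt_Suc)
    have "transpose_mat (unfold 1 X) $$ (i, a) = unfold 1 X $$ (a, i)"
      using ia by (simp add: dims del: upt_Suc)
    also have "\<dots> = entry X ([a] @ row_major (?ds @ [1]) i)"
      using ia by (subst unfold_index) (simp_all add: dims del: upt_Suc)
    also have "\<dots> = entry X (a # row_major ?ds i @ [0])" by (simp only: rm append.simps)
    also have "\<dots> = of_bool (enum (T k) a = position ?ds (row_major ?ds i))"
      unfolding X_def by (rule entry_chain_suffix[OF assms row_major_indices[OF ia(1)] ia(3)])
    also have "\<dots> = selection_mat (N k) ?n (enum (T k)) $$ (i, a)"
      using ia by (auto simp: position_row_major selection_mat_index simp del: upt_Suc)
    finally show "transpose_mat (unfold 1 X) $$ (i, a) = selection_mat (N k) ?n (enum (T k)) $$ (i, a)" .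
  qed (simp_all add: dims N del: upt_Suc)
qed

section \<open>Families of prefixes and suffixes\<close>

lemma prod_list_map_upt: "prod_list (map d [a..<b]) = (\<Prod>j\<in>{a..<b}. d j)"
  using prod.distinct_set_conv_list[of "[a..<b]" d] by simp

lemma prod_list_upt_split:
  fixes d :: "nat \<Rightarrow> nat"
  shows "a \<le> b \<Longrightarrow> b \<le> c \<Longrightarrow> prod_list (map d [a..<c]) = prod_list (map d [a..<b]) * prod_list (map d [b..<c])"
  using upt_add_eq_append[of a b "c - b"] by simp

text \<open>
  There is room for \<open>min R N\<close> elements, and filling it makes the ranks next to the core as large as
  the bound \<open>R\<close> and the numbers of multi-indices permit.
\<close>

lemma padded_subset:
  assumes "P \<subseteq> {..<N::nat}" "card P \<le> R"
  obtains P' where "P \<subseteq> P'" "P' \<subseteq> {..<N}" "card P' = min R N"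
  using exists_subset_between[of P "min R N" "{..<N}"] assms card_mono[of "{..<N}" P] by auto

text \<open>
  The sets consist of the truncations of one padded set of prefixes of length \<open>k - 1\<close>, so none has
  more elements than that set. The set \<open>S 0\<close> is an exception: it contains the empty prefix even
  if \<open>P\<close> is empty.
\<close>

lemma prefix_family:
  assumes k: "1 \<le> k" and P: "P \<subseteq> {..<prod_list (map d [1..<k])}" "card P \<le> R"
  obtains S where "S 0 = {0}" "P \<subseteq> S (k - 1)"
    "\<And>j. j < k \<Longrightarrow> finite (S j)"
    "\<And>j. j < k \<Longrightarrow> S j \<subseteq> {..<prod_list (map d [1..<Suc j])}"
    "\<And>j. j \<in> {1..<k} \<Longrightarrow> card (S j) \<le> R"
    "\<And>j n. j \<in> {1..<k} \<Longrightarrow> n \<in> S j \<Longrightarrow> n div d j \<in> S (j - 1)"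
    "1 \<le> R \<Longrightarrow> R \<le> prod_list (map d [1..<k]) \<Longrightarrow> card (S (k - 1)) = R"
proof -
  obtain P' where P': "P \<subseteq> P'" "P' \<subseteq> {..<prod_list (map d [1..<k])}"
    "card P' = min R (prod_list (map d [1..<k]))"
    using padded_subset[OF P] .
  have finP: "finite P'" using P'(2) finite_subset by blast
  define S where "S j = (if j = 0 then {0} else (\<lambda>n. n div prod_list (map d [Suc j..<k])) ` P')" for j
  show thesis
  proof
    show "S 0 = {0}" by (simp add: S_def)
    show "P \<subseteq> S (k - 1)" using P' k by (cases "k = 1") (auto simp: S_def)
    show "finite (S j)" for j using finP by (simp add: S_def)
    show "S j \<subseteq> {..<prod_list (map d [1..<Suc j])}" if "j < k" for j
    proof (cases "j = 0")
      case False
      have "n div prod_list (map d [Suc j..<k]) < prod_list (map d [1..<Suc j])" if "n \<in> P'" for n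
        using that P'(2) \<open>j < k\<close> prod_list_upt_split[of 1 "Suc j" k d]
        by (intro less_mult_imp_div_less) (auto simp del: upt_Suc)
      then show ?thesis using False by (auto simp: S_def simp del: upt_Suc)
    qed (simp add: S_def)
    show "card (S j) \<le> R" if "j \<in> {1..<k}" for j
      using card_image_le[OF finP, of "\<lambda>n. n div prod_list (map d [Suc j..<k])"] P'(3) that
      by (simp add: S_def)
    show "n div d j \<in> S (j - 1)" if j: "j \<in> {1..<k}" and n: "n \<in> S j" for j n
    proof -
      obtain m where m: "m \<in> P'" "n = m div prod_list (map d [Suc j..<k])"
        using n j by (auto simp: S_def)
      have "prod_list (map d [j..<k]) = d j * prod_list (map d [Suc j..<k])"
        using j by (simp add: upt_conv_Cons)
      then have "n div d j = m div prod_list (map d [j..<k])"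
        using m(2) by (simp add: div_mult2_eq[symmetric] mult.commute)
      then show ?thesis using m(1) P'(2) j by (cases "j = 1") (auto simp: S_def)
    qed
    show "card (S (k - 1)) = R" if "1 \<le> R" "R \<le> prod_list (map d [1..<k])"
      using that k P'(3) by (cases "k = 1") (auto simp: S_def)
  qed
qed

text \<open>
  As for prefixes, with remainders in place of quotients: successive remainders agree with the last
  one, because each \<open>N j\<close> divides its predecessor.
\<close>

lemma suffix_family:
  assumes k: "k \<le> M" and N: "\<And>j. N j = prod_list (map d [Suc j..<Suc M])"
    and P: "P \<subseteq> {..<N k}" "card P \<le> R"
  obtains T where "T M = {0}" "P \<subseteq> T k"
    "\<And>j. j \<in> {k..M} \<Longrightarrow> finite (T j)"
    "\<And>j. j \<in> {k..M} \<Longrightarrow> T j \<subseteq> {..<N j}"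
    "\<And>j. j \<in> {k..<M} \<Longrightarrow> card (T j) \<le> R"
    "\<And>j n. j \<in> {k<..M} \<Longrightarrow> n \<in> T (j - 1) \<Longrightarrow> n mod N j \<in> T j"
    "1 \<le> R \<Longrightarrow> R \<le> N k \<Longrightarrow> card (T k) = R"
proof -
  obtain P' where P': "P \<subseteq> P'" "P' \<subseteq> {..<N k}" "card P' = min R (N k)"
    using padded_subset[OF P] .
  have finP: "finite P'" using P'(2) finite_subset by blast
  define T where "T j = (if j = M then {0} else (\<lambda>n. n mod N j) ` P')" for j
  have NM: "N M = 1" by (simp add: N)
  have mod_k: "n mod N k = n" if "n \<in> P'" for n using P'(2) that by auto
  show thesis
  proof
    show "T M = {0}" by (simp add: T_def)
    show "P \<subseteq> T k" using P' NM mod_k by (cases "k = M") (force simp: T_def)+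
    show "finite (T j)" for j using finP by (simp add: T_def)
    show "T j \<subseteq> {..<N j}" if "j \<in> {k..M}" for j
    proof (cases "j = M")
      case False
      have "0 < N j" if "n \<in> P'" for n
        using that P'(2) \<open>j \<in> {k..M}\<close> prod_list_upt_split[of "Suc k" "Suc j" "Suc M" d]
        by (intro Nat.gr0I) (auto simp: N simp del: upt_Suc)
      then show ?thesis using False by (auto simp: T_def)
    qed (simp add: T_def NM)
    show "card (T j) \<le> R" if "j \<in> {k..<M}" for j
      using card_image_le[OF finP, of "\<lambda>n. n mod N j"] P'(3) that by (simp add: T_def)
    show "n mod N j \<in> T j" if j: "j \<in> {k<..M}" and n: "n \<in> T (j - 1)" for j n
    proof (cases "j = M")
      case False
      obtain m where m: "m \<in> P'" "n = m mod N (j - 1)"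
        using n j False by (auto simp: T_def split: if_splits)
      have "N (j - 1) = d j * N j" using j by (simp add: N upt_conv_Cons[of j] del: upt_Suc)
      then have "n mod N j = m mod N j" using m(2) by (simp add: mod_mod_cancel)
      then show ?thesis using m(1) False by (simp add: T_def)
    qed (simp add: T_def NM)
    show "card (T k) = R" if "1 \<le> R" "R \<le> N k"
    proof (cases "k = M")
      case False
      have "(\<lambda>n. n mod N k) ` P' = P'" using mod_k by force
      then show ?thesis using that P'(3) False by (simp add: T_def)
    qed (use that NM in \<open>simp add: T_def\<close>)
  qed
qed

section \<open>Sparse tensors in sparsely canonicalised form\<close>

theorem theorem40:
  fixes M k R :: nat and d :: "nat \<Rightarrow> nat" and A :: "real tensor"
  assumes "dims A = map d [1..<M + 1]"
    and "sparse R A"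
    and "k \<in> {1..M}"
  shows "\<exists>r U C V.
    tt_representation M d r k U C V A \<and>
    sparse_orthogonal_frames M r k U V \<and>
    sparse R C \<and>
    (1 \<le> R \<and> R \<le> (\<Prod>j \<in> {1..<k}. d j) \<and> R \<le> (\<Prod>j \<in> {k<..M}. d j)
       \<longrightarrow> sparsely_canonicalised M d r k U C V A) \<and>
    (\<forall>j \<in> {1..<M}. r j \<le> R) \<and>
    (let Q = core_operator M d k U V in
       Q \<in> carrier_mat (\<Prod>j \<in> {1..M}. d j) (r (k - 1) * d k * r k) \<and>
       vectorise A = Q *\<^sub>v vectorise C \<and>
       transpose_mat Q * Q = 1\<^sub>m (dim_col Q) \<and>
       (\<forall>j < dim_col Q. \<exists>i < dim_row Q. col Q j = unit_vec (dim_row Q) i) \<and>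
       (\<forall>(q :: ennreal) (\<omega> :: ennreal tensor). dims \<omega> = dims A \<longrightarrow>
          (let \<beta> = transpose_mat (map_mat ennreal Q) *\<^sub>v vectorise \<omega> in
             weighted_norm q (vectorise \<omega>) (vectorise A) = weighted_norm q \<beta> (vectorise C) \<and>
             subseq (list_of_vec \<beta>) (list_of_vec (vectorise \<omega>)))))"
proof -
  define a where "a = vectorise A"
  define N1 where "N1 = prod_list (map d [1..<k])"
  define N where "N j = prod_list (map d [Suc j..<Suc M])" for j
  define supp where "supp = {n. n < N1 * d k * N k \<and> a $ n \<noteq> 0}"
  have k: "1 \<le> k" "k \<le> M" using assms(3) by auto
  have upt: "[1..<M + 1] = [1..<k] @ k # [Suc k..<Suc M]"
    using upt_add_eq_append[of 1 k "Suc M - k"] upt_conv_Cons[of k "Suc M"] k by simp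
  have dimsA: "dims A = map d [1..<k] @ d k # map d [Suc k..<Suc M]"
    unfolding assms(1) upt by simp
  have prodA: "prod_list (dims A) = N1 * d k * N k"
    by (simp add: dimsA N1_def N_def del: upt_Suc)
  have card_supp: "card supp = R"
    using assms(2) by (simp add: sparse_vectorise prodA supp_def a_def)
  have fin_supp: "finite supp" by (simp add: supp_def)

  \<comment> \<open>the prefixes of the multi-indices of non-zero entries\<close>
  have "(\<lambda>n. n div (d k * N k)) ` supp \<subseteq> {..<prod_list (map d [1..<k])}"
    by (auto simp: supp_def N1_def mult.assoc intro!: less_mult_imp_div_less)
  then obtain S where S0: "S 0 = {0}" and S_supp: "(\<lambda>n. n div (d k * N k)) ` supp \<subseteq> S (k - 1)"
    and S_fin: "\<And>j. j < k \<Longrightarrow> finite (S j)"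
    and S_le: "\<And>j. j < k \<Longrightarrow> S j \<subseteq> {..<prod_list (map d [1..<Suc j])}"
    and S_card: "\<And>j. j \<in> {1..<k} \<Longrightarrow> card (S j) \<le> R"
    and S_div: "\<And>j n. j \<in> {1..<k} \<Longrightarrow> n \<in> S j \<Longrightarrow> n div d j \<in> S (j - 1)"
    and S_eq: "1 \<le> R \<Longrightarrow> R \<le> prod_list (map d [1..<k]) \<Longrightarrow> card (S (k - 1)) = R"
    using card_image_le[OF fin_supp, of "\<lambda>n. n div (d k * N k)"] card_supp
    by (elim prefix_family[OF k(1)]) auto
  \<comment> \<open>the suffixes of the multi-indices of non-zero entries\<close>
  have "(\<lambda>n. n mod N k) ` supp \<subseteq> {..<N k}"
    by (auto simp: supp_def intro!: mod_less_divisor Nat.gr0I)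
  then obtain T where TM: "T M = {0}" and T_supp: "(\<lambda>n. n mod N k) ` supp \<subseteq> T k"
    and T_fin: "\<And>j. j \<in> {k..M} \<Longrightarrow> finite (T j)"
    and T_le: "\<And>j. j \<in> {k..M} \<Longrightarrow> T j \<subseteq> {..<N j}"
    and T_card: "\<And>j. j \<in> {k..<M} \<Longrightarrow> card (T j) \<le> R"
    and T_mod: "\<And>j n. j \<in> {k<..M} \<Longrightarrow> n \<in> T (j - 1) \<Longrightarrow> n mod N j \<in> T j"
    and T_eq: "1 \<le> R \<Longrightarrow> R \<le> N k \<Longrightarrow> card (T k) = R"
    using card_image_le[OF fin_supp, of "\<lambda>n. n mod N k"] card_supp
    by (elim suffix_family[OF k(2) N_def]) auto

  define r where "r j = (if j < k then card (S j) else card (T j))" for j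
  define U where "U j = prefix_core (d j) (S (j - 1)) (S j)" for j
  define V where "V j = suffix_core (d j) (N j) (T (j - 1)) (T j)" for j
  define s where "s = enum (S (k - 1))"
  define t where "t = enum (T k)"
  define p where "p = card (S (k - 1))"
  define q where "q = card (T k)"
  \<comment> \<open>the row in which column \<open>m\<close> of the operator has its 1; \<open>m\<close> encodes the rank of a prefix,
     the index of mode \<open>k\<close> and the rank of a suffix\<close>
  define f where "f m = (s (m div q div d k) * d k + m div q mod d k) * N k + t (m mod q)" for m
  define C where "C = Tensor [p, d k, q] (\<lambda>is. a $ f (position [p, d k, q] is))"
  have r: "r 0 = 1" "r M = 1" "r (k - 1) = p" "r k = q"
    using k S0 TM by (auto simp: r_def p_def q_def)
  have fin: "finite (S (k - 1))" "finite (T k)" using S_fin T_fin k by auto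
  have S_le': "S (k - 1) \<subseteq> {..<N1}" using S_le[of "k - 1"] k by (simp add: N1_def)
  have T_le': "T k \<subseteq> {..<N k}" using T_le k by simp
  have s: "strict_mono_on {..<p} s" "s ` {..<p} \<subseteq> {..<N1}"
    using enum_strict_mono enum_in S_le' fin by (auto simp: s_def p_def)
  have t: "strict_mono_on {..<q} t" "t ` {..<q} \<subseteq> {..<N k}"
    using enum_strict_mono enum_in T_le' fin by (auto simp: t_def q_def)
  have id: "strict_mono_on {..<d k} (\<lambda>i. i)" "(\<lambda>i. i) ` {..<d k} \<subseteq> {..<d k}"
    by (auto simp: strict_mono_on_def)
  note sd = strict_mono_on_kronecker[OF s(1) id] kronecker_image_le[OF s(2) id(2)]
  have f_mono: "strict_mono_on {..<p * d k * q} f" and f_im: "f ` {..<p * d k * q} \<subseteq> {..<N1 * d k * N k}"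
    unfolding f_def using strict_mono_on_kronecker[OF sd(1) t] kronecker_image_le[OF sd(2) t(2)] by simp_all
  have f_inj: "inj_on f {..<p * d k * q}" using f_mono by (rule strict_mono_on_imp_inj_on)
  have f_supp: "n \<in> f ` {..<p * d k * q}" if n: "n < N1 * d k * N k" "a $ n \<noteq> 0" for n
  proof -
    \<comment> \<open>the prefix and the suffix of \<open>n\<close> have ranks \<open>x\<close> and \<open>y\<close>,
       and these together with the index of mode \<open>k\<close> give a preimage\<close>
    have "n \<in> supp" using n by (simp add: supp_def)
    then have "n div (d k * N k) \<in> S (k - 1)" "n mod N k \<in> T k" using S_supp T_supp by auto
    then obtain x y where x: "x < p" "s x = n div (d k * N k)" and y: "y < q" "t y = n mod N k"
      using enum_onto[OF fin(1)] enum_onto[OF fin(2)] unfolding s_def t_def p_def q_def by blast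
    let ?i = "n div N k mod d k"
    have pos: "0 < d k" "0 < N k" using n(1) by (auto intro: Nat.gr0I)
    have i: "?i < d k" using pos by simp
    have "f ((x * d k + ?i) * q + y) = (s x * d k + ?i) * N k + t y"
      using y(1) i by (simp add: f_def)
    also have "s x = n div N k div d k" by (simp add: x(2) div_mult2_eq[symmetric] mult.commute)
    finally have "f ((x * d k + ?i) * q + y) = n" by (simp add: y(2))
    moreover have "(x * d k + ?i) * q + y < p * d k * q"
    proof -
      have "position [p, d k, q] [x, ?i, y] < prod_list [p, d k, q]"
        using x(1) i y(1) by (intro position_less) simp
      then show ?thesis by (simp add: algebra_simps)
    qed
    ultimately show ?thesis by (intro image_eqI[of n f "(x * d k + ?i) * q + y"]) auto
  qed
  have dim_a: "dim_vec a = N1 * d k * N k" by (simp add: a_def prodA)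
  have vecC: "vectorise C = vec (p * d k * q) (\<lambda>j. a $ f j)"
    by (rule eq_vecI) (simp_all add: C_def vectorise_index position_row_major mult.assoc
        del: position.simps row_major.simps)

  have U_dims: "dims (U j) = [r (j - 1), d j, r j]" if "j \<in> {1..<k}" for j
    using that by (auto simp: U_def r_def)
  have V_dims: "dims (V j) = [r (j - 1), d j, r j]" if "j \<in> {k<..M}" for j
    using that by (auto simp: V_def r_def)
  have Q: "core_operator M d k U V = selection_mat (N1 * d k * N k) (p * d k * q) f"
  proof -
    have "unfold k (chain (map U [1..<k])) = selection_mat N1 p s"
      unfolding U_def N1_def p_def s_def by (rule unfold_chain_prefix[OF k(1) S0 S_fin S_div])
    moreover have "transpose_mat (unfold 1 (chain (map V [k + 1..<M + 1]))) = selection_mat (N k) q t"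
      unfolding V_def q_def t_def Suc_eq_plus1[symmetric]
      by (rule unfold_chain_suffix[OF k(2) TM T_fin N_def T_mod])
    ultimately show ?thesis
      unfolding core_operator_def one_mat_selection f_def
      by (simp only: kronecker_selection_mat[OF id(2)] kronecker_selection_mat[OF t(2)])
  qed

  have "entry A is = entry (chain (map U [1..<k] @ [C] @ map V [k + 1..<M + 1])) ([0] @ is @ [0])"
    if ind: "is \<in> indices (dims A)" for "is"
  proof -
    let ?ds = "map d [1..<k]" and ?es = "map d [Suc k..<Suc M]"
    obtain js ls where js: "is = js @ ls" "js \<in> indices ?ds" "ls \<in> indices (d k # ?es)"
      using ind unfolding dimsA by (rule indices_appendE)
    obtain i ks where ks: "ls = i # ks" "i < d k" "ks \<in> indices ?es"
      using js(3) by (rule indices_ConsE)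
    note ix = js(1)[unfolded ks(1)] js(2) ks(2,3)
    let ?x = "position ?ds js" and ?y = "position ?es ks"
    let ?n = "(?x * d k + i) * N k + ?y"
    have n: "position (dims A) is = ?n" "?n < N1 * d k * N k"
    proof -
      show "position (dims A) is = ?n" unfolding dimsA ix(1)
        using indices_length[OF ix(2)]
        by (simp add: position_append N_def algebra_simps del: upt_Suc)
      then show "?n < N1 * d k * N k" using position_less[OF ind] by (simp add: prodA)
    qed
    have y: "?y < N k" using position_less[OF ix(4)] by (simp add: N_def)
    have "entry (chain (map U [1..<k] @ [C] @ map V [k + 1..<M + 1])) ([0] @ is @ [0]) =
      (\<Sum>b<p. \<Sum>c<q. entry (chain (map U [1..<k])) (0 # js @ [b]) *
        (entry C [b, i, c] * entry (chain (map V [k + 1..<M + 1])) (c # ks @ [0])))"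
      unfolding ix(1)
    proof (rule entry_train)
      show "last (dims (chain (map U [1..<k]))) = p"
        by (subst dims_chain[where r = r and d = d]) (use k r U_dims in auto)
      show "q = 1 \<and> ks = []" if "map V [k + 1..<M + 1] = []"
      proof -
        have "M = k" using that k by (simp split: if_splits)
        then show ?thesis using r(2,4) indices_length[OF ix(4)] by simp
      qed
    qed (use U_dims indices_length[OF ix(2)] in \<open>auto simp: C_def\<close>)
    also have "\<dots> = (\<Sum>b<p. \<Sum>c<q. of_bool (s b = ?x) *
        (a $ ((s b * d k + i) * N k + t c) * of_bool (t c = ?y)))"
    proof (intro sum.cong refl arg_cong2[where f = "(*)"])
      fix b c assume bc: "b \<in> {..<p}" "c \<in> {..<q}"
      show "entry (chain (map U [1..<k])) (0 # js @ [b]) = of_bool (s b = ?x)"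
        using entry_chain_prefix[OF k(1) S0 S_fin S_div ix(2)] bc
        by (simp add: U_def[abs_def] s_def p_def)
      show "entry (chain (map V [k + 1..<M + 1])) (c # ks @ [0]) = of_bool (t c = ?y)"
        using entry_chain_suffix[OF k(2) TM T_fin N_def T_mod ix(4)] bc
        by (simp add: V_def[abs_def] t_def q_def del: upt_Suc)
      have "position [p, d k, q] [b, i, c] = (b * d k + i) * q + c" by (simp add: algebra_simps)
      then show "entry C [b, i, c] = a $ ((s b * d k + i) * N k + t c)"
        using bc ix(3) by (simp add: C_def f_def del: position.simps)
    qed
    also have "\<dots> = (\<Sum>b<p. \<Sum>y\<in>T k. of_bool (s b = ?x) *
        (a $ ((s b * d k + i) * N k + y) * of_bool (y = ?y)))"
      unfolding t_def q_def by (intro sum.cong refl sum_enum[OF fin(2)])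
    also have "\<dots> = (\<Sum>x\<in>S (k - 1). \<Sum>y\<in>T k. of_bool (x = ?x) *
        (a $ ((x * d k + i) * N k + y) * of_bool (y = ?y)))"
      unfolding s_def p_def by (rule sum_enum[OF fin(1)])
    also have "\<dots> = (\<Sum>x\<in>S (k - 1). \<Sum>y\<in>T k. if y = ?y then if x = ?x then a $ ?n else 0 else 0)"
      by (intro sum.cong) auto
    also have "\<dots> = (\<Sum>x\<in>S (k - 1). if x = ?x then if ?y \<in> T k then a $ ?n else 0 else 0)"
      using fin(2) by (intro sum.cong refl) (auto simp del: upt_Suc)
    also have "\<dots> = (if ?x \<in> S (k - 1) \<and> ?y \<in> T k then a $ ?n else 0)"
      using fin(1) by (simp del: upt_Suc One_nat_def)
    also have "\<dots> = a $ ?n"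
    \<comment> \<open>a non-zero entry of \<open>A\<close> has its prefix in \<open>S (k - 1)\<close> and its suffix in \<open>T k\<close>\<close>
    proof (cases "a $ ?n = 0")
      case False
      then have "?n \<in> supp" using n(2) by (simp add: supp_def)
      moreover have "?n div (d k * N k) = ?x"
        using y ix(3) by (simp add: mult.commute[of "d k"] div_mult2_eq)
      moreover have "?n mod N k = ?y" using y by simp
      ultimately have "?x \<in> S (k - 1)" "?y \<in> T k" using S_supp T_supp by force+
      then show ?thesis by simp
    qed simp
    also have "\<dots> = entry A is" using entry_eq_vectorise[OF ind] n(1) by (simp add: a_def)
    finally show ?thesis by simp
  qed
  then have tt: "tt_representation M d r k U C V A"
    unfolding tt_representation_def using r U_dims V_dims assms(1) by (auto simp: C_def)

  have frames: "sparse_orthogonal_frames M r k U V"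
    unfolding sparse_orthogonal_frames_def
  proof (intro conjI ballI)
    fix j assume j: "j \<in> {1..<k}"
    \<comment> \<open>\<open>d j = 0\<close> would leave no multi-index to be a prefix\<close>
    have "0 < d j" if "n \<in> S j" for n
    proof -
      have "0 < prod_list (map d [1..<Suc j])" using S_le[of j] that j by (auto simp del: upt_Suc)
      then show ?thesis using j by simp
    qed
    then have "binary (U j) \<and> left_orthogonal (U j) \<and> sparse (card (S j)) (U j)"
      unfolding U_def using S_fin S_div j by (intro prefix_core_frame) auto
    then show "binary (U j)" "left_orthogonal (U j)" "sparse (r j) (U j)"
      using j by (simp_all add: r_def)
  next
    fix j assume j: "j \<in> {k<..M}"
    then have jk: "j - 1 \<in> {k..M}" "j \<in> {k..M}" by auto
    have "n div N j < d j" if "n \<in> T (j - 1)" for n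
    proof -
      have "N (j - 1) = d j * N j" using j by (simp add: N_def upt_conv_Cons[of j] del: upt_Suc)
      moreover have "n < N (j - 1)" using T_le[OF jk(1)] that by blast
      ultimately show ?thesis by (simp add: less_mult_imp_div_less)
    qed
    then have "binary (V j) \<and> right_orthogonal (V j) \<and> sparse (card (T (j - 1))) (V j)"
      unfolding V_def using T_fin[OF jk(1)] T_fin[OF jk(2)] T_mod[OF j] T_le[OF jk(2)]
      by (intro suffix_core_frame)
    then show "binary (V j)" "right_orthogonal (V j)" "sparse (r (j - 1)) (V j)"
      using j by (auto simp: r_def)
  qed

  have sparseC: "sparse R C"
  proof -
    have "f ` {j. j < p * d k * q \<and> a $ f j \<noteq> 0} = supp"
      using f_im by (auto simp: supp_def dest!: f_supp)
    moreover have "inj_on f {j. j < p * d k * q \<and> a $ f j \<noteq> 0}"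
      using f_inj by (rule inj_on_subset) auto
    ultimately have "card {j. j < p * d k * q \<and> a $ f j \<noteq> 0} = R"
      using card_supp card_image by metis
    moreover have "prod_list (dims C) = p * d k * q" by (simp add: C_def)
    ultimately show ?thesis by (simp add: sparse_vectorise vecC cong: conj_cong)
  qed

  have canon: "sparsely_canonicalised M d r k U C V A"
    if "1 \<le> R" "R \<le> (\<Prod>j\<in>{1..<k}. d j)" "R \<le> (\<Prod>j\<in>{k<..M}. d j)"
  proof -
    have "{k<..M} = {Suc k..<Suc M}" by auto
    then have "p = R" "q = R"
      using that S_eq T_eq by (simp_all add: p_def q_def N_def prod_list_map_upt del: upt_Suc)
    then show ?thesis using tt frames sparseC r by (simp add: sparsely_canonicalised_def)
  qed

  have ranks: "\<forall>j\<in>{1..<M}. r j \<le> R" using S_card T_card by (simp add: r_def)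

  have "weighted_norm x (vectorise w) a = weighted_norm x (vec (p * d k * q) (\<lambda>j. vectorise w $ f j)) (vectorise C)"
    for x and w :: "ennreal tensor"
    unfolding vecC by (rule weighted_norm_selection[OF f_inj f_im dim_a f_supp])
  moreover have "subseq (list_of_vec (vec (p * d k * q) (\<lambda>j. vectorise w $ f j))) (list_of_vec (vectorise w))"
    if "dims w = dims A" for w :: "ennreal tensor"
  proof -
    let ?xs = "list_of_vec (vectorise w)"
    have len: "length ?xs = N1 * d k * N k" using that by (simp add: prodA)
    have eq: "list_of_vec (vec (p * d k * q) (\<lambda>j. vectorise w $ f j)) = map (\<lambda>j. ?xs ! f j) [0..<p * d k * q]"
      using f_im len by (intro nth_equalityI) (auto simp: list_of_vec_index image_subset_iff)
    show ?thesis
      unfolding eq using f_im len by (intro subseq_map_nth_strict_mono[OF f_mono]) simp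
  qed
  moreover have "transpose_mat (map_mat ennreal (core_operator M d k U V)) *\<^sub>v vectorise w =
      vec (p * d k * q) (\<lambda>j. vectorise w $ f j)" if "dims w = dims A" for w
    unfolding Q using f_im that by (intro transpose_selection_mat_mult_vec) (auto simp: prodA)
  moreover have "a = core_operator M d k U V *\<^sub>v vectorise C"
    unfolding Q vecC using selection_mat_mult_vec[OF f_inj f_im dim_a f_supp] by simp
  moreover have "(\<Prod>j\<in>{1..M}. d j) = N1 * d k * N k"
  proof -
    have "{1..M} = {1..<M + 1}" by auto
    then show ?thesis using prodA unfolding assms(1) prod_list_map_upt by simp
  qed
  moreover have "\<exists>i<N1 * d k * N k. col (core_operator M d k U V) j = unit_vec (N1 * d k * N k) i"
    if "j < p * d k * q" for j
  proof -
    have "f j < N1 * d k * N k" using f_im that by auto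
    then show ?thesis unfolding Q using selection_mat_col[OF that] by blast
  qed
  moreover have "transpose_mat (core_operator M d k U V) * core_operator M d k U V = 1\<^sub>m (p * d k * q)"
    unfolding Q by (rule selection_mat_orthogonal[OF f_inj f_im])
  moreover have "dim_row (core_operator M d k U V) = N1 * d k * N k" "dim_col (core_operator M d k U V) = p * d k * q"
    unfolding Q by simp_all
  ultimately show ?thesis
    using tt frames sparseC canon ranks r
    by (intro exI[of _ r] exI[of _ U] exI[of _ C] exI[of _ V]) (auto simp: Let_def a_def)
qed

end
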